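(* Let $T$ be a tree on $n$ vertices, and let $H$ be a graph generalized cospectral with $T$. Then $|V(H)|=n$, $|E(H)|=n-1$, and $H$ is bipartite. Moreover, $$\beta(H)=c(H)-1\le \kappa_{\mathrm m}(T)-1.$$ If $q(H)$ denotes the number of connected components of $H$ that contain a cycle, then $$q(H)\le c(H)-1\le \kappa_{\mathrm m}(T)-1.$$ In particular, $H$ has at least one tree component. If $\kappa_{\mathrm m}(T)=1$, then $H$ is connected and hence is a tree.
   Context: All graphs are finite, simple and undirected. For a graph $G$, $A(G)$ is its adjacency matrix, $\phi_G(x)=\det(xI-A(G))$, $\mathbf 1$ is the all-one vector, $c(G)$ is the number of connected components, and $\beta(G):=|E(G)|-|V(G)|+c(G)$ is the cycle rank. Two graphs are generalized cospectral if they have the same adjacency spectrum and their complements have the same adjacency spectrum. An adjacency eigenvalue is main if its eigenspace is not orthogonal to $\mathbf 1$; the main polynomial $M_G(x)$ is the product of $(x-\lambda)$ over the distinct main eigenvalues $\lambda$ of $G$ (it divides $\phi_G$ in $\mathbb Z[x]$). If $\phi_G=\prod_{i=1}^r f_i^{m_i}$ with $f_i$ distinct, monic and irreducible over $\mathbb Q$, the main-factor multiplicity is $\kappa_{\mathrm m}(G):=\sum_{i:\,f_i\mid M_G} m_i$. *)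

theory Defs
  imports
    "Graph_Theory.Digraph_Component"
    "Jordan_Normal_Form.Char_Poly"
    "HOL-Computational_Algebra.Field_as_Ring"
begin

text \<open>
  A finite simple undirected graph is a \<^const>\<open>pair_graph\<close>: a finite, loop-free digraph without
  parallel arcs whose arc relation is symmetric. Each undirected edge is thus a pair of
  opposite arcs.
\<close>

definition edges :: "'a pair_pre_digraph \<Rightarrow> 'a set set" where
  "edges G = {{u, v} | u v. (u, v) \<in> parcs G}"

definition complement_graph :: "'a pair_pre_digraph \<Rightarrow> 'a pair_pre_digraph" where
  "complement_graph G = \<lparr> pverts = pverts G,
     parcs = {(u, v). u \<in> pverts G \<and> v \<in> pverts G \<and> u \<noteq> v \<and> (u, v) \<notin> parcs G} \<rparr>"

definition bipartite :: "'a pair_pre_digraph \<Rightarrow> bool" where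
  "bipartite G \<longleftrightarrow> (\<exists>X Y. X \<union> Y = pverts G \<and> X \<inter> Y = {} \<and>
     (\<forall>(u, v) \<in> parcs G. (u \<in> X \<and> v \<in> Y) \<or> (u \<in> Y \<and> v \<in> X)))"

text \<open>
  \<^const>\<open>pre_digraph.cycle\<close> is the notion for directed multigraphs, which in a symmetric digraph
  also admits the walk back and forth along a single edge. The length bound excludes
  this. For the same reason the library's \<^const>\<open>tree\<close> cannot be used for undirected graphs.
\<close>

definition contains_cycle :: "('a, 'b) pre_digraph \<Rightarrow> bool" where
  "contains_cycle G \<longleftrightarrow> (\<exists>p. pre_digraph.cycle G p \<and> 3 \<le> length p)"

definition tree_graph :: "('a, 'b) pre_digraph \<Rightarrow> bool" where
  "tree_graph G \<longleftrightarrow> Digraph_Component.connected G \<and> \<not> contains_cycle G"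

text \<open>
  In a symmetric digraph the strongly connected components are the connected components
  of the underlying undirected graph.
\<close>

definition components :: "'a pair_pre_digraph \<Rightarrow> ('a, 'a \<times> 'a) pre_digraph set" where
  "components G = pre_digraph.sccs (with_proj G)"

definition num_components :: "'a pair_pre_digraph \<Rightarrow> nat" where
  "num_components G = card (components G)"

definition num_cyclic_components :: "'a pair_pre_digraph \<Rightarrow> nat" where
  "num_cyclic_components G = card {C \<in> components G. contains_cycle C}"

definition cycle_rank :: "'a pair_pre_digraph \<Rightarrow> int" where
  "cycle_rank G = int (card (edges G)) - int (card (pverts G)) + int (num_components G)"

text \<open>
  The matrices are indexed by \<open>0, \<dots>, n - 1\<close>, so an arbitrary enumeration of the vertices is
  fixed. Another choice conjugates the adjacency matrix by a permutation matrix, which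
  fixes the all-one vector, and so changes none of the notions defined below.
\<close>

definition vertex_list :: "'a pair_pre_digraph \<Rightarrow> 'a list" where
  "vertex_list G = (SOME xs. distinct xs \<and> set xs = pverts G)"

definition adjacency_mat :: "'a pair_pre_digraph \<Rightarrow> 'c :: {zero, one} mat" where
  "adjacency_mat G = mat (card (pverts G)) (card (pverts G))
     (\<lambda>(i, j). if (vertex_list G ! i, vertex_list G ! j) \<in> parcs G then 1 else 0)"

text \<open>
  Eigenvalues with multiplicity. The adjacency matrix is real symmetric, so all its
  eigenvalues are real.
\<close>

definition adjacency_spectrum :: "'a pair_pre_digraph \<Rightarrow> real multiset" where
  "adjacency_spectrum G = proots (char_poly (adjacency_mat G))"

definition generalized_cospectral :: "'a pair_pre_digraph \<Rightarrow> 'b pair_pre_digraph \<Rightarrow> bool" where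
  "generalized_cospectral G H \<longleftrightarrow>
     adjacency_spectrum G = adjacency_spectrum H \<and>
     adjacency_spectrum (complement_graph G) = adjacency_spectrum (complement_graph H)"

definition main_eigenvalue :: "'a pair_pre_digraph \<Rightarrow> real \<Rightarrow> bool" where
  "main_eigenvalue G \<mu> \<longleftrightarrow>
     (\<exists>v. eigenvector (adjacency_mat G) v \<mu> \<and> v \<bullet> vec (card (pverts G)) (\<lambda>_. 1) \<noteq> 0)"

definition main_poly :: "'a pair_pre_digraph \<Rightarrow> real poly" where
  "main_poly G = (\<Prod>\<mu> | main_eigenvalue G \<mu>. [:- \<mu>, 1:])"

text \<open>
  The factors \<open>f\<close> are those of the characteristic polynomial over the rationals. The main
  polynomial has integer coefficients but is a real polynomial by definition, so that
  divisibility by \<open>f\<close> is tested over the reals. This agrees with divisibility over the rationals.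
\<close>

definition main_factor_multiplicity :: "'a pair_pre_digraph \<Rightarrow> nat" where
  "main_factor_multiplicity G =
     (let \<phi> = char_poly (adjacency_mat G :: rat mat) in
      \<Sum>f | lead_coeff f = 1 \<and> irreducible f \<and> f dvd \<phi> \<and> map_poly of_rat f dvd main_poly G.
        multiplicity f \<phi>)"

end

theory Submission
  imports
    Defs
    "Jordan_Normal_Form.Jordan_Normal_Form_Existence"
    "Jordan_Normal_Form.Jordan_Normal_Form_Uniqueness"
begin

text \<open>
  The power sums of the adjacency spectrum are the traces of the powers of the adjacency matrix,
  so the spectrum determines the numbers of vertices and edges and whether there are closed walks
  of odd length. Hence \<open>H\<close> has \<open>n\<close> vertices and \<open>n - 1\<close> edges and is bipartite. A component with a
  cycle has at least as many edges as vertices, so not all components of \<open>H\<close> contain a cycle.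

  For the bound on the number of components, let \<open>A\<close> be the adjacency matrix. The matrices \<open>A\<close> and
  \<open>-1 - (J - 1 - A) = A - J\<close> agree on the vectors orthogonal to the all-one vector. Comparing
  eigenspaces, \<open>\<mu>\<close> is a main eigenvalue iff its multiplicity in \<open>A\<close> exceeds the multiplicity of
  \<open>-1 - \<mu>\<close> in the complement. This depends only on the two characteristic polynomials, and only on
  the rational irreducible factor \<open>f\<close> with root \<open>\<mu>\<close>, so all roots of \<open>f\<close> are main if one is.
  Each component has a main eigenvalue, since otherwise the spectrum of its complement would be
  \<open>-1 - \<mu>\<close> for \<open>\<mu>\<close> in its spectrum, contradicting that both traces vanish. Extending eigenvectors
  by zero makes it a main eigenvalue of \<open>H\<close>. The components that belong to the same irreducible
  factor \<open>f\<close> all have each root of \<open>f\<close> as an eigenvalue, which gives eigenvectors of \<open>H\<close> with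
  disjoint supports. So there are at most as many of them as the multiplicity of \<open>f\<close>.
\<close>

section \<open>Symmetric real matrices\<close>

text \<open>
  Linear independence without the carrier records of the library's vector spaces.
\<close>

definition indep :: "nat \<Rightarrow> real vec set \<Rightarrow> bool" where
  "indep n S \<longleftrightarrow> finite S \<and> S \<subseteq> carrier_vec n \<and>
     (\<forall>a. (\<forall>i<n. (\<Sum>x\<in>S. a x * x $ i) = 0) \<longrightarrow> (\<forall>x\<in>S. a x = 0))"

text \<open>For a finite set a dependence can be taken with coefficients on the whole set, and a
  vector equation is a family of coordinate equations.\<close>

lemma indep_iff_lin_indpt:
  assumes "finite S" "S \<subseteq> carrier_vec n"
  shows "indep n S \<longleftrightarrow> \<not> module.lin_dep class_ring (module_vec TYPE(real) n) S"
proof -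
  interpret vec_space "TYPE(real)" n .
  have eq: "lincomb a S = 0\<^sub>v n \<longleftrightarrow> (\<forall>i<n. (\<Sum>x\<in>S. a x * x $ i) = 0)" for a
    using lincomb_index[OF _ assms(2), of _ a] lincomb_dim[OF assms, of a] by auto
  have li: "lin_dep S \<longleftrightarrow> (\<exists>a. lincomb a S = 0\<^sub>v n \<and> (\<exists>x\<in>S. a x \<noteq> 0))"
  proof
    assume "lin_dep S"
    then show "\<exists>a. lincomb a S = 0\<^sub>v n \<and> (\<exists>x\<in>S. a x \<noteq> 0)"
      using finite_lin_dep[OF assms(1) _ ] assms(2) by fastforce
  next
    assume "\<exists>a. lincomb a S = 0\<^sub>v n \<and> (\<exists>x\<in>S. a x \<noteq> 0)"
    then show "lin_dep S"
      using assms unfolding lin_dep_def by (auto simp: class_ring_simps)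
  qed
  show ?thesis
    unfolding indep_def li eq using assms by blast
qed

text \<open>Independence inside the kernel coincides with independence in the ambient space
  (\<open>lindep_same\<close>). Together with the next lemma this describes
  \<open>kernel_dim\<close> as the largest size of an \<open>indep\<close> subset of the
  kernel.\<close>

lemma indep_card_le_kernel_dim:
  assumes A: "A \<in> carrier_mat m n" and S: "S \<subseteq> mat_kernel A" "indep n S"
  shows "card S \<le> kernel_dim A"
proof -
  interpret kernel m n A using A by unfold_locales
  obtain B where B: "finite B" "basis B" using kernel_basis_exists[OF A] by blast
  have "Ker.fin_dim" using B unfolding Ker.fin_dim_def Ker.basis_def by auto
  moreover have "lin_indpt S"
    using lindep_same[OF S(1)] S(2) indep_iff_lin_indpt[of S n] unfolding indep_def by blast
  ultimately show ?thesis using Ker.li_le_dim(2)[of S] S(1) by simp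
qed

lemma kernel_dim_indep:
  assumes A: "A \<in> carrier_mat m n"
  obtains S where "S \<subseteq> mat_kernel A" "indep n S" "card S = kernel_dim A"
proof -
  interpret kernel m n A using A by unfold_locales
  obtain B where B: "finite B" "basis B" using kernel_basis_exists[OF A] by blast
  have sub: "B \<subseteq> mat_kernel A" and li: "lin_indpt B"
    using B(2) unfolding Ker.basis_def by auto
  have "indep n B"
    using indep_iff_lin_indpt[of B n] B(1) sub lindep_same[OF sub] li mat_kernel_carrier[OF A] by auto
  with sub that[of B] show thesis using Ker.dim_basis[OF B] by simp
qed

section \<open>Reality of the spectrum, and equality of algebraic and geometric
  multiplicities\<close>

text \<open>For an eigenvector \<open>v\<close>, the Hermitian form \<open>s\<close> of
  \<open>A\<close> at \<open>v\<close> equals \<open>c\<close> times the squared norm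
  \<open>t\<close> of \<open>v\<close>. As \<open>A\<close> is real and symmetric, \<open>s\<close>
  is fixed by conjugation, and \<open>t\<close> is positive.\<close>

lemma real_symmetric_eigenvalue_real:
  fixes A :: "real mat"
  assumes A: "A \<in> carrier_mat n n" and sym: "\<And>i j. i < n \<Longrightarrow> j < n \<Longrightarrow> A $$ (i, j) = A $$ (j, i)"
    and ev: "eigenvalue (map_mat complex_of_real A) c"
  shows "c \<in> \<real>"
proof -
  obtain v where v: "v \<in> carrier_vec n" "v \<noteq> 0\<^sub>v n" "map_mat complex_of_real A *\<^sub>v v = c \<cdot>\<^sub>v v"
    using ev A unfolding eigenvalue_def eigenvector_def by auto
  have row: "c * v $ i = (\<Sum>j<n. complex_of_real (A $$ (i, j)) * v $ j)" if "i < n" for i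
    using arg_cong[OF v(3), of "\<lambda>w. w $ i"] that A v(1)
    by (auto simp: scalar_prod_def lessThan_atLeast0)
  define s where "s = (\<Sum>i<n. \<Sum>j<n. cnj (v $ i) * (complex_of_real (A $$ (i, j)) * v $ j))"
  define t where "t = (\<Sum>i<n. (cmod (v $ i))\<^sup>2)"
  have "s = (\<Sum>i<n. cnj (v $ i) * (c * v $ i))"
    unfolding s_def by (rule sum.cong) (simp_all add: row sum_distrib_left)
  also have "\<dots> = c * complex_of_real t"
    unfolding t_def of_real_sum sum_distrib_left
    by (rule sum.cong) (simp_all add: complex_norm_square mult.commute mult.left_commute del: of_real_power)
  finally have s: "s = c * complex_of_real t" .
  have "cnj s = (\<Sum>i<n. \<Sum>j<n. cnj (v $ j) * (complex_of_real (A $$ (j, i)) * v $ i))"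
    unfolding s_def by (auto intro!: sum.cong simp: sym)
  also have "\<dots> = s" unfolding s_def by (rule sum.swap)
  finally have "cnj c * complex_of_real t = c * complex_of_real t" using s by simp
  moreover have "t > 0"
  proof -
    obtain i where "i < n" "v $ i \<noteq> 0" using v(1,2) by (metis carrier_vecD eq_vecI index_zero_vec)
    then show ?thesis unfolding t_def by (intro sum_pos2[of _ i]) auto
  qed
  ultimately have "cnj c = c" by simp
  then show ?thesis using Reals_cnj_iff by blast
qed

text \<open>Over the complex numbers the polynomial splits. Its roots are real by the previous
  lemma, and the embedding of the reals is injective on coefficients.\<close>

lemma real_symmetric_char_poly_splits:
  fixes A :: "real mat"
  assumes A: "A \<in> carrier_mat n n" and sym: "\<And>i j. i < n \<Longrightarrow> j < n \<Longrightarrow> A $$ (i, j) = A $$ (j, i)"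
  obtains es where "char_poly A = (\<Prod>a\<leftarrow>es. [:- a, 1:])"
proof -
  let ?A = "map_mat complex_of_real A"
  have cA: "?A \<in> carrier_mat n n" using A by simp
  obtain cs where cs: "char_poly ?A = (\<Prod>a\<leftarrow>cs. [:- a, 1:])" using char_poly_factorized[OF cA] by blast
  have real: "c \<in> \<real>" if "c \<in> set cs" for c
  proof (rule real_symmetric_eigenvalue_real[OF A sym])
    have "poly (char_poly ?A) c = 0" unfolding cs poly_prod_list using that by (auto simp: prod_list_zero_iff)
    then show "eigenvalue ?A c" using eigenvalue_root_char_poly[OF cA] by blast
  qed auto
  interpret map_poly_hom: map_poly_comm_ring_hom complex_of_real ..
  have "map_poly complex_of_real (\<Prod>a\<leftarrow>map Re cs. [:- a, 1:]) = (\<Prod>a\<leftarrow>cs. [:- a, 1:])"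
    using real
  proof (induction cs)
    case (Cons c cs)
    then have "map_poly complex_of_real [:- Re c, 1:] = [:- c, 1:]" by (simp add: map_poly_pCons)
    moreover have "map_poly complex_of_real (p * q) = map_poly complex_of_real p * map_poly complex_of_real q" for p q
      using map_poly_hom.hom_mult .
    ultimately show ?case using Cons by (simp del: mult_pCons_left)
  qed simp
  also have "\<dots> = map_poly complex_of_real (char_poly A)"
    by (simp only: cs[symmetric] of_real_hom.char_poly_hom[OF A])
  finally have eq: "map_poly complex_of_real (\<Prod>a\<leftarrow>map Re cs. [:- a, 1:]) = map_poly complex_of_real (char_poly A)" .
  have "char_poly A = (\<Prod>a\<leftarrow>map Re cs. [:- a, 1:])"
  proof (rule poly_eqI)
    fix k
    have "complex_of_real (coeff (\<Prod>a\<leftarrow>map Re cs. [:- a, 1:]) k) = complex_of_real (coeff (char_poly A) k)"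
      using arg_cong[OF eq, of "\<lambda>p. coeff p k"] by (simp only: coeff_map_poly of_real_0)
    then show "coeff (char_poly A) k = coeff (\<Prod>a\<leftarrow>map Re cs. [:- a, 1:]) k" by (simp only: of_real_eq_iff)
  qed
  then show thesis by (rule that)
qed

lemma scalar_prod_self_eq_0_iff:
  fixes w :: "real vec"
  assumes "w \<in> carrier_vec n"
  shows "w \<bullet> w = 0 \<longleftrightarrow> w = 0\<^sub>v n"
  using assms by (auto simp: scalar_prod_def sum_nonneg_eq_0_iff intro!: eq_vecI)

lemma symmetric_scalar_prod_mult_mat_vec:
  fixes A :: "real mat"
  assumes A: "A \<in> carrier_mat n n" and sym: "\<And>i j. i < n \<Longrightarrow> j < n \<Longrightarrow> A $$ (i, j) = A $$ (j, i)"
    and v: "v \<in> carrier_vec n" and w: "w \<in> carrier_vec n"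
  shows "v \<bullet> (A *\<^sub>v w) = (A *\<^sub>v v) \<bullet> w"
proof -
  have "v \<bullet> (A *\<^sub>v w) = (\<Sum>i=0..<n. \<Sum>j=0..<n. v $ i * (A $$ (i, j) * w $ j))"
    using A v w by (auto simp: scalar_prod_def sum_distrib_left intro!: sum.cong)
  also have "\<dots> = (\<Sum>j=0..<n. \<Sum>i=0..<n. v $ i * (A $$ (i, j) * w $ j))" by (rule sum.swap)
  also have "\<dots> = (A *\<^sub>v v) \<bullet> w"
    using A v w by (auto simp: scalar_prod_def sum_distrib_right sym intro!: sum.cong)
  finally show ?thesis .
qed

text \<open>The order is the total size of the Jordan blocks at \<open>x\<close>, the kernel
  dimension is their number. Symmetry rules out blocks of size two or more.\<close>

lemma symmetric_order_char_poly:
  fixes A :: "real mat"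
  assumes A: "A \<in> carrier_mat n n" and sym: "\<And>i j. i < n \<Longrightarrow> j < n \<Longrightarrow> A $$ (i, j) = A $$ (j, i)"
  shows "Polynomial.order x (char_poly A) = kernel_dim (char_matrix A x)"
proof -
  let ?B = "char_matrix A x"
  have B: "?B \<in> carrier_mat n n" using A by simp
  have symB: "?B $$ (i, j) = ?B $$ (j, i)" if "i < n" "j < n" for i j
    using that A sym by (auto simp: char_matrix_def)
  obtain es where "char_poly A = (\<Prod>a\<leftarrow>es. [:- a, 1:])" using real_symmetric_char_poly_splits[OF A sym] by blast
  then obtain n_as where jnf: "jordan_nf A n_as" using jordan_nf_exists[OF A] by blast
  \<comment> \<open>If \<open>?B\<close> applied twice kills \<open>v\<close>, then self-adjointness
    makes the squared norm of \<open>?B *\<^sub>v v\<close> vanish.\<close>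
  have "mat_kernel (?B * ?B) = mat_kernel ?B"
  proof
    show "mat_kernel ?B \<subseteq> mat_kernel (?B * ?B)" by (rule mat_kernel_mult_subset[OF B B])
  next
    show "mat_kernel (?B * ?B) \<subseteq> mat_kernel ?B"
    proof
      fix v assume "v \<in> mat_kernel (?B * ?B)"
      then have v: "v \<in> carrier_vec n" "?B *\<^sub>v (?B *\<^sub>v v) = 0\<^sub>v n"
        using mat_kernel[of "?B * ?B" n n] B assoc_mult_mat_vec[OF B B] by auto
      have "(?B *\<^sub>v v) \<bullet> (?B *\<^sub>v v) = v \<bullet> (?B *\<^sub>v (?B *\<^sub>v v))"
        by (rule symmetric_scalar_prod_mult_mat_vec[OF B symB v(1), symmetric]) (use B v in auto)
      also have "\<dots> = 0" using v by simp
      finally have "?B *\<^sub>v v = 0\<^sub>v n" using scalar_prod_self_eq_0_iff[of "?B *\<^sub>v v" n] B v by simp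
      then show "v \<in> mat_kernel ?B" using mat_kernelI[OF B v(1)] by simp
    qed
  qed
  then have "kernel_dim (?B * ?B) = kernel_dim ?B" unfolding kernel_dim_def using B by simp
  then have dims: "dim_gen_eigenspace A x 2 = dim_gen_eigenspace A x 1"
    unfolding dim_gen_eigenspace_def using B by (simp add: numeral_2_eq_2)
  let ?l = "map fst (filter (\<lambda>na. snd na = x) n_as)"
  have eq: "dim_gen_eigenspace A x k = sum_list (map (min k) ?l)" for k
    unfolding dim_gen_eigenspace[OF jnf] by (simp add: case_prod_unfold)
  \<comment> \<open>A block of size \<open>m\<close> contributes \<open>min k m\<close> to the
    kernel dimension of the \<open>k\<close>-th power. Equality of the totals for
    \<open>k = 1\<close> and \<open>k = 2\<close> forces every block size to be at most 1.\<close>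
  have small: "sum_list ns = sum_list (map (min 1) ns)"
    if "sum_list (map (min 2) ns) = sum_list (map (min 1) ns)" for ns :: "nat list"
    using that
  proof (induction ns)
    case (Cons m ns)
    have "sum_list (map (min 1) ns) \<le> sum_list (map (min 2) ns)" by (rule sum_list_mono) simp
    moreover have "min 1 m \<le> min 2 m" by simp
    moreover have "min 2 m + sum_list (map (min 2) ns) = min 1 m + sum_list (map (min 1) ns)"
      using Cons.prems by (simp only: list.map sum_list.Cons)
    ultimately have "min 2 m = min 1 m" and eq: "sum_list (map (min 2) ns) = sum_list (map (min 1) ns)"
      by linarith+
    then have "min 1 m = m" by (simp add: min_def split: if_splits)
    with Cons.IH[OF eq] show ?case by (simp only: list.map sum_list.Cons)
  qed simp
  have "Polynomial.order x (char_poly A) = sum_list ?l" by (rule jordan_nf_order[OF jnf])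
  also have "\<dots> = dim_gen_eigenspace A x 1" unfolding eq using dims eq by (intro small) simp
  also have "\<dots> = kernel_dim ?B" unfolding dim_gen_eigenspace_def using B by simp
  finally show ?thesis .
qed

section \<open>Traces of matrix powers as power sums of eigenvalues\<close>

text \<open>In the product of two upper triangular matrices the term through \<open>l\<close> at
  entry \<open>(i, j)\<close> vanishes unless \<open>i \<le> l \<le> j\<close>. On the diagonal only
  \<open>l = i\<close> survives.\<close>

lemma upper_triangular_pow:
  fixes B :: "'a :: comm_ring_1 mat"
  assumes B: "B \<in> carrier_mat n n" and ut: "upper_triangular B"
  shows "upper_triangular (B ^\<^sub>m k) \<and> (\<forall>i<n. (B ^\<^sub>m k) $$ (i, i) = (B $$ (i, i)) ^ k)"
proof (induction k)
  case 0
  then show ?case using B by (auto simp: upper_triangular_def)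
next
  case (Suc k)
  let ?C = "B ^\<^sub>m k"
  have C: "?C \<in> carrier_mat n n" using B by simp
  have prod: "(?C * B) $$ (i, j) = (\<Sum>l=0..<n. ?C $$ (i, l) * B $$ (l, j))" if "i < n" "j < n" for i j
    using that B C by (simp add: scalar_prod_def)
  have z1: "?C $$ (i, l) = 0" if "l < i" "i < n" for i l
    using Suc that C unfolding upper_triangular_def by auto
  have z2: "B $$ (l, j) = 0" if "j < l" "l < n" for j l
    using ut that B unfolding upper_triangular_def by auto
  have low: "(?C * B) $$ (i, j) = 0" if "j < i" "i < n" for i j
  proof -
    have "?C $$ (i, l) * B $$ (l, j) = 0" if "l < n" for l
      using z1[of l i] z2[of j l] \<open>j < i\<close> \<open>i < n\<close> that by (cases "l < i") auto
    then show ?thesis using that by (subst prod) (auto intro!: sum.neutral)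
  qed
  have diag: "(?C * B) $$ (i, i) = ?C $$ (i, i) * B $$ (i, i)" if "i < n" for i
  proof -
    have "(?C * B) $$ (i, i) = (\<Sum>l\<in>{i}. ?C $$ (i, l) * B $$ (l, i))"
      unfolding prod[OF that that]
    proof (rule sum.mono_neutral_right)
      show "\<forall>l\<in>{0..<n} - {i}. ?C $$ (i, l) * B $$ (l, i) = 0"
      proof
        fix l assume "l \<in> {0..<n} - {i}"
        then show "?C $$ (i, l) * B $$ (l, i) = 0"
          using z1[of l i] z2[of i l] that by (cases "l < i") auto
      qed
    qed (use that in auto)
    then show ?thesis by simp
  qed
  show ?case using Suc B C low diag by (auto simp: upper_triangular_def)
qed

lemma sum_diag_mult_commute:
  fixes A B :: "'a :: comm_ring_1 mat"
  assumes "A \<in> carrier_mat n n" "B \<in> carrier_mat n n"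
  shows "(\<Sum>i<n. (A * B) $$ (i, i)) = (\<Sum>i<n. (B * A) $$ (i, i))"
proof -
  have "(\<Sum>i<n. (A * B) $$ (i, i)) = (\<Sum>i<n. \<Sum>j<n. A $$ (i, j) * B $$ (j, i))"
    using assms by (auto simp: scalar_prod_def lessThan_atLeast0 intro!: sum.cong)
  also have "\<dots> = (\<Sum>j<n. \<Sum>i<n. A $$ (i, j) * B $$ (j, i))" by (rule sum.swap)
  also have "\<dots> = (\<Sum>i<n. (B * A) $$ (i, i))"
    using assms by (auto simp: scalar_prod_def lessThan_atLeast0 mult.commute intro!: sum.cong)
  finally show ?thesis .
qed

text \<open>Schur decomposition gives \<open>A ^\<^sub>m k\<close> as \<open>P\<close>,
  \<open>B ^\<^sub>m k\<close>, \<open>Q\<close> multiplied together, with \<open>B\<close>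
  triangular and \<open>es\<close> on its diagonal. Moving \<open>Q\<close> to the front does not
  change the trace, and there it cancels \<open>P\<close>.\<close>

lemma sum_diag_pow_eq_sum_list:
  fixes A :: "real mat"
  assumes A: "A \<in> carrier_mat n n" and es: "char_poly A = (\<Prod>a\<leftarrow>es. [:- a, 1:])"
  shows "(\<Sum>i<n. (A ^\<^sub>m k) $$ (i, i)) = (\<Sum>a\<leftarrow>es. a ^ k)"
proof -
  obtain B P Q where dec: "schur_decomposition A es = (B, P, Q)" by (cases "schur_decomposition A es")
  then have wit: "similar_mat_wit A B P Q" and ut: "upper_triangular B" and diag: "diag_mat B = es"
    using schur_decomposition[OF A es] by auto
  note w = similar_mat_witD2[OF A wit]
  have B: "B \<in> carrier_mat n n" and P: "P \<in> carrier_mat n n" and Q: "Q \<in> carrier_mat n n" using w by auto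
  have Bk: "B ^\<^sub>m k \<in> carrier_mat n n" using B by simp
  have "similar_mat_wit (A ^\<^sub>m k) (B ^\<^sub>m k) P Q" by (rule similar_mat_wit_pow[OF wit])
  then have "A ^\<^sub>m k = (P * B ^\<^sub>m k) * Q" by (rule similar_mat_witD2(3)[OF pow_carrier_mat[OF A]])
  then have "(\<Sum>i<n. (A ^\<^sub>m k) $$ (i, i)) = (\<Sum>i<n. (Q * (P * B ^\<^sub>m k)) $$ (i, i))"
    using sum_diag_mult_commute[OF mult_carrier_mat[OF P Bk] Q] by (simp only:)
  also have "Q * (P * B ^\<^sub>m k) = B ^\<^sub>m k"
    using assoc_mult_mat[OF Q P Bk, symmetric] w(2) Bk by (simp only: left_mult_one_mat)
  also have "(\<Sum>i<n. (B ^\<^sub>m k) $$ (i, i)) = (\<Sum>i<n. (diag_mat B ! i) ^ k)"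
    using upper_triangular_pow[OF B ut, of k] B by (auto simp: diag_mat_def intro!: sum.cong)
  also have "\<dots> = (\<Sum>a\<leftarrow>es. a ^ k)"
    using B unfolding diag[symmetric] by (simp add: sum_list_sum_nth diag_mat_def lessThan_atLeast0)
  finally show ?thesis .
qed

lemma proots_prod_linear: "proots (\<Prod>a\<leftarrow>es. [:- a, 1 :: 'a :: idom:]) = mset es"
proof (induction es)
  case (Cons a es)
  let ?p = "\<Prod>a\<leftarrow>es. [:- a, 1 :: 'a:]"
  have "0 \<notin> set (map (\<lambda>a. [:- a, 1 :: 'a:]) es)" by auto
  then have "?p \<noteq> 0" unfolding prod_list_zero_iff .
  then have "proots ([:- a, 1:] * ?p) = {#a#} + proots ?p"
    by (subst proots_mult) (simp_all del: mult_pCons_left)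
  with Cons show ?case by (simp del: mult_pCons_left)
qed simp

lemma symmetric_sum_diag_pow:
  fixes A :: "real mat"
  assumes A: "A \<in> carrier_mat n n" and sym: "\<And>i j. i < n \<Longrightarrow> j < n \<Longrightarrow> A $$ (i, j) = A $$ (j, i)"
  shows "(\<Sum>i<n. (A ^\<^sub>m k) $$ (i, i)) = (\<Sum>a\<in>#proots (char_poly A). a ^ k)"
proof -
  obtain es where es: "char_poly A = (\<Prod>a\<leftarrow>es. [:- a, 1:])"
    using real_symmetric_char_poly_splits[OF A sym] by blast
  show ?thesis unfolding sum_diag_pow_eq_sum_list[OF A es] unfolding es proots_prod_linear
    by (simp add: sum_mset_sum_list flip: mset_map)
qed

lemma symmetric_char_poly_proots:
  fixes A :: "real mat"
  assumes A: "A \<in> carrier_mat n n" and sym: "\<And>i j. i < n \<Longrightarrow> j < n \<Longrightarrow> A $$ (i, j) = A $$ (j, i)"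
  shows "char_poly A = (\<Prod>a\<in>#proots (char_poly A). [:- a, 1:])" and "size (proots (char_poly A)) = n"
proof -
  obtain es where es: "char_poly A = (\<Prod>a\<leftarrow>es. [:- a, 1:])"
    using real_symmetric_char_poly_splits[OF A sym] by blast
  then have pr: "proots (char_poly A) = mset es" by (simp add: proots_prod_linear)
  show "char_poly A = (\<Prod>a\<in>#proots (char_poly A). [:- a, 1:])"
    unfolding pr using es by (metis mset_map prod_mset_prod_list)
  have "degree (char_poly A) = length es" using degree_linear_factors[of uminus es] unfolding es .
  then show "size (proots (char_poly A)) = n" using degree_monic_char_poly[OF A] pr by simp
qed

section \<open>Irreducible rational polynomials and their real roots\<close>

lemma map_poly_of_rat_hom:
  fixes p q :: "rat poly"
  shows map_poly_of_rat_add: "map_poly real_of_rat (p + q) = map_poly of_rat p + map_poly of_rat q"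
    and map_poly_of_rat_mult: "map_poly real_of_rat (p * q) = map_poly of_rat p * map_poly of_rat q"
    and map_poly_of_rat_power: "map_poly real_of_rat (p ^ n) = map_poly of_rat p ^ n"
proof -
  interpret map_poly_comm_ring_hom real_of_rat ..
  show "map_poly real_of_rat (p + q) = map_poly of_rat p + map_poly of_rat q" by (rule hom_add)
  show "map_poly real_of_rat (p * q) = map_poly of_rat p * map_poly of_rat q" by (rule hom_mult)
  show "map_poly real_of_rat (p ^ n) = map_poly of_rat p ^ n" by (rule hom_power)
qed

text \<open>A Bezout identity \<open>a * f + b * q = 1\<close> over the rationals, evaluated at a
  common real root, would read \<open>0 = 1\<close>.\<close>

lemma irreducible_not_dvd_no_common_root:
  fixes f q :: "rat poly" and x :: real
  assumes f: "irreducible f" "poly (map_poly of_rat f) x = 0" and q: "\<not> f dvd q"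
  shows "poly (map_poly of_rat q) x \<noteq> 0"
proof
  assume "poly (map_poly of_rat q) x = 0"
  have "coprime f q" using f(1) q by (simp add: irreducible_imp_prime_elem prime_elem_imp_coprime)
  then obtain a b where "a * f + b * q = 1" using bezout_coefficients_fst_snd[of f q] by auto
  then have "map_poly of_rat (a * f + b * q) = (1 :: real poly)" by simp
  then have "poly (map_poly of_rat a) x * poly (map_poly of_rat f) x
      + poly (map_poly of_rat b) x * poly (map_poly of_rat q) x = 1"
    by (metis map_poly_of_rat_add map_poly_of_rat_mult poly_1 poly_add poly_mult)
  with f(2) \<open>poly (map_poly of_rat q) x = 0\<close> show False by simp
qed

text \<open>The derivative is nonzero of smaller degree, so \<open>f\<close> does not divide it and
  it shares no root with \<open>f\<close>.\<close>

lemma irreducible_order_root: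
  fixes f :: "rat poly" and x :: real
  assumes f: "irreducible f" "poly (map_poly of_rat f) x = 0"
  shows "Polynomial.order x (map_poly of_rat f) = 1"
proof -
  have f0: "map_poly of_rat f \<noteq> (0 :: real poly)" using f(1) by auto
  have "degree f \<noteq> 0"
  proof
    assume "degree f = 0"
    then obtain c where "f = [:c:]" by (metis degree_eq_zeroE)
    with f show False by (auto simp: map_poly_pCons)
  qed
  then have "pderiv f \<noteq> 0" "degree (pderiv f) < degree f"
    by (auto simp: pderiv_eq_0_iff degree_pderiv)
  then have "\<not> f dvd pderiv f" using dvd_imp_degree_le by fastforce
  then have "poly (map_poly of_rat (pderiv f)) x \<noteq> 0" by (rule irreducible_not_dvd_no_common_root[OF f])
  then have "Polynomial.order x (pderiv (map_poly of_rat f)) = 0"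
    by (simp add: of_rat_hom.map_poly_pderiv order_0I)
  with order_pderiv[OF f0 f(2)] show ?thesis by simp
qed

text \<open>Split off from \<open>p\<close> the full power of \<open>f\<close>. Each factor
  \<open>f\<close> contributes order 1 at \<open>x\<close>, and the remaining factor does not vanish
  there.\<close>

lemma order_eq_multiplicity:
  fixes f p :: "rat poly" and x :: real
  assumes f: "irreducible f" "poly (map_poly of_rat f) x = 0" and p: "p \<noteq> 0"
  shows "Polynomial.order x (map_poly of_rat p) = multiplicity f p"
proof -
  have power: "Polynomial.order x (g ^ n) = n * Polynomial.order x g" if "g \<noteq> 0" for g :: "real poly" and n
    using that by (induction n) (simp_all add: order_mult)
  obtain q where q: "p = f ^ multiplicity f p * q" "\<not> f dvd q"
    using multiplicity_decompose'[of p f] f(1) p by (auto simp: irreducible_def)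
  have "map_poly of_rat p = map_poly of_rat f ^ multiplicity f p * (map_poly of_rat q :: real poly)"
    by (subst q(1)) (simp only: map_poly_of_rat_mult map_poly_of_rat_power)
  moreover have "map_poly of_rat p \<noteq> (0 :: real poly)" using p by simp
  moreover have "Polynomial.order x (map_poly of_rat q) = 0"
    by (rule order_0I, rule irreducible_not_dvd_no_common_root[OF f q(2)])
  ultimately show ?thesis
    using irreducible_order_root[OF f] power[of "map_poly of_rat f" "multiplicity f p"] f(1)
    by (auto simp: order_mult)
qed

text \<open>Some prime factor of \<open>p\<close> vanishes at \<open>x\<close>. Primes are
  normalized, and a normalized rational polynomial is monic.\<close>

lemma exists_minimal_polynomial:
  fixes p :: "rat poly" and x :: real
  assumes p: "p \<noteq> 0" "poly (map_poly of_rat p) x = 0"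
  obtains f where "lead_coeff f = 1" "irreducible f" "poly (map_poly of_rat f) x = 0"
proof -
  have "p dvd prod_mset (prime_factorization p)" using p(1) by (simp add: prod_mset_prime_factorization)
  then obtain r where "prod_mset (prime_factorization p) = p * r" by (rule dvdE)
  then have "poly (map_poly of_rat (prod_mset (prime_factorization p))) x = 0"
    using p(2) by (simp add: map_poly_of_rat_mult)
  moreover have "\<exists>g\<in>#A. poly (map_poly of_rat g) x = 0"
    if "poly (map_poly real_of_rat (prod_mset A)) x = 0" for A :: "rat poly multiset"
    using that by (induction A) (auto simp: map_poly_of_rat_mult)
  ultimately obtain g where g: "g \<in># prime_factorization p" "poly (map_poly of_rat g) x = 0" by blast
  have "irreducible g" using g(1) by (meson in_prime_factors_imp_prime prime_elem_imp_irreducible prime_imp_prime_elem)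
  moreover have "lead_coeff g = 1"
  proof -
    have "prime g" using g(1) by (rule in_prime_factors_imp_prime)
    then have "normalize g = g" "g \<noteq> 0" by (auto simp: normalize_prime)
    then show ?thesis
      using coeff_normalize[of g "degree g", unfolded \<open>normalize g = g\<close>] by (simp add: unit_factor_rat_def)
  qed
  ultimately show thesis using that g(2) by blast
qed

text \<open>Let \<open>h\<close> be the cofactor of \<open>gcd p q\<close> in \<open>p\<close>. A
  root of \<open>h\<close> would also be a root of the gcd, hence a double root of \<open>p\<close>.
  So \<open>h\<close> has no roots, yet it divides a product of linear factors, which makes it a
  unit.\<close>

lemma dvd_if_simple_roots:
  fixes p q :: "real poly"
  assumes split: "p dvd (\<Prod>a\<in>#X. [:- a, 1:])"
    and roots: "\<And>x. poly p x = 0 \<Longrightarrow> Polynomial.order x p = 1 \<and> poly q x = 0"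
  shows "p dvd q"
proof -
  have p0: "p \<noteq> 0" using split by (auto simp: prod_mset_zero_iff)
  obtain h where h: "p = gcd p q * h" by (meson dvdE gcd_dvd1)
  have nr: "poly h x \<noteq> 0" for x
  proof
    assume hx: "poly h x = 0"
    then have px: "poly p x = 0" by (subst h) simp
    with roots have "[:- x, 1:] dvd gcd p q" by (simp add: dvd_iff_poly_eq_0)
    moreover have "[:- x, 1:] dvd h" using hx by (simp add: dvd_iff_poly_eq_0)
    ultimately have "[:- x, 1:] ^ 2 dvd p" by (subst h) (simp only: power2_eq_square mult_dvd_mono)
    then show False using roots[OF px] p0 by (simp add: order_divides)
  qed
  have "coprime h (\<Prod>a\<in>#X. [:- a, 1:])"
  proof (induction X)
    case (add a X)
    have "\<not> [:- a, 1:] dvd h" using nr[of a] by (simp add: dvd_iff_poly_eq_0)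
    moreover have "prime_elem [:- a, 1:]" by (simp add: prime_elem_linear_field_poly)
    ultimately have "coprime h [:- a, 1:]" using prime_elem_imp_coprime coprime_commute by blast
    with add show ?case by (simp del: mult_pCons_left)
  qed simp
  moreover have "h dvd (\<Prod>a\<in>#X. [:- a, 1:])" using split h by (metis dvd_mult_right)
  ultimately have "is_unit h" by (metis coprime_common_divisor dvd_refl)
  then have "p dvd gcd p q" by (subst h) (simp add: mult_unit_dvd_iff)
  then show ?thesis by simp
qed

text \<open>Substituting \<open>-1 - X\<close> for \<open>X\<close> turns the linear factor at
  \<open>-1 - x\<close> into minus the linear factor at \<open>x\<close>. This relates eigenvalues
  of the complement to those of the graph.\<close>

lemma order_pcompose_reflect:
  fixes p :: "real poly"
  assumes "p \<noteq> 0"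
  shows "Polynomial.order x (pcompose p [:- 1, - 1:]) = Polynomial.order (- 1 - x) p"
proof -
  define y where "y = - 1 - x"
  obtain q where q: "p = [:- y, 1:] ^ Polynomial.order y p * q" "\<not> [:- y, 1:] dvd q"
    using order_decomp[OF assms] by blast
  let ?k = "Polynomial.order y p"
  let ?r = "Polynomial.smult ((- 1) ^ ?k) (pcompose q [:- 1, - 1:])"
  have pow: "pcompose (a ^ n) b = pcompose a b ^ n" for a b :: "real poly" and n
    by (induction n) (simp_all add: pcompose_mult pcompose_1)
  have lin: "pcompose [:- y, 1:] [:- 1, - 1:] = Polynomial.smult (- 1) [:- x, 1:]" by (simp add: y_def pcompose_pCons)
  have "pcompose p [:- 1, - 1:] = [:- x, 1:] ^ ?k * ?r"
    by (subst q(1)) (simp only: pcompose_mult pow lin smult_power mult_smult_left mult_smult_right)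
  moreover have "poly ?r x \<noteq> 0" using q(2) by (simp add: poly_pcompose dvd_iff_poly_eq_0 y_def algebra_simps)
  moreover from this have "[:- x, 1:] ^ ?k * ?r \<noteq> 0" by (metis mult_eq_0_iff pCons_eq_0_iff poly_0 power_eq_0_iff one_neq_zero)
  ultimately show ?thesis
    using order_mult[of "[:- x, 1:] ^ ?k" ?r x] order_0I[of ?r x] order_power_n_n[of x ?k]
    unfolding y_def[symmetric] by (metis add_0_right)
qed

section \<open>Trees and cycles\<close>

lemma (in pair_graph) connected_iff_rtrancl:
  "Digraph_Component.connected (with_proj G) \<longleftrightarrow>
     pverts G \<noteq> {} \<and> (\<forall>u\<in>pverts G. \<forall>v\<in>pverts G. (u, v) \<in> (parcs G)\<^sup>*)"
proof -
  have "(parcs G)\<^sup>s = parcs G" by (auto simp: symcl_def dest: arcs_symmetric)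
  then have "Digraph_Component.connected (with_proj G) \<longleftrightarrow>
      pverts G \<noteq> {} \<and> (\<forall>u\<in>pverts G. \<forall>v\<in>pverts G. u \<rightarrow>\<^sup>*\<^bsub>with_proj G\<^esub> v)"
    by (simp add: connected_conv reachable_def)
  then show ?thesis by (auto simp: reachable_conv)
qed

text \<open>Here \<open>d\<close> is the distance from \<open>r\<close>, and \<open>p v\<close> is
  the last vertex before \<open>v\<close> on a shortest walk. Minimality at \<open>v\<close> and at
  its predecessor makes the distances differ by exactly one.\<close>

lemma (in pair_graph) bfs_parents:
  assumes r: "r \<in> pverts G" and conn: "\<And>v. v \<in> pverts G \<Longrightarrow> (r, v) \<in> (parcs G)\<^sup>*"
  shows "\<exists>(d :: 'a \<Rightarrow> nat) p. \<forall>v \<in> pverts G - {r}. (v, p v) \<in> parcs G \<and> d v = Suc (d (p v))"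
proof -
  define d where "d v = (LEAST k. (r, v) \<in> parcs G ^^ k)" for v
  have "\<exists>u. (v, u) \<in> parcs G \<and> d v = Suc (d u)" if v: "v \<in> pverts G - {r}" for v
  proof -
    obtain k where "(r, v) \<in> parcs G ^^ k" using conn v rtrancl_imp_relpow by blast
    then have dv: "(r, v) \<in> parcs G ^^ d v" unfolding d_def by (rule LeastI)
    obtain m where m: "d v = Suc m" using dv v by (cases "d v") auto
    then obtain u where u: "(r, u) \<in> parcs G ^^ m" "(u, v) \<in> parcs G" using dv by auto
    have "d u \<le> m" unfolding d_def using u(1) by (rule Least_le)
    moreover have "d v \<le> Suc (d u)"
    proof -
      have "(r, u) \<in> parcs G ^^ d u" unfolding d_def using u(1) by (rule LeastI)
      with u(2) have "(r, v) \<in> parcs G ^^ Suc (d u)" by auto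
      then show ?thesis unfolding d_def[of v] by (rule Least_le)
    qed
    ultimately show ?thesis using m arcs_symmetric[OF u(2)] by (intro exI[of _ u]) simp
  qed
  then show ?thesis by metis
qed

text \<open>If two different vertices had the same parent edge, each would be the parent of the
  other, and each would have the larger depth. So the edges are as many as the non-root
  vertices.\<close>

lemma card_parent_edges:
  fixes d :: "'a \<Rightarrow> nat"
  assumes "finite V" "r \<in> V" and dp: "\<And>v. v \<in> V - {r} \<Longrightarrow> d v = Suc (d (p v))"
  shows "Suc (card ((\<lambda>v. {v, p v}) ` (V - {r}))) = card V"
proof -
  have "inj_on (\<lambda>v. {v, p v}) (V - {r})"
  proof (rule inj_onI)
    fix v w assume vw: "v \<in> V - {r}" "w \<in> V - {r}" and eq: "{v, p v} = {w, p w}"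
    show "v = w"
    proof (rule ccontr)
      assume "v \<noteq> w"
      with eq have "p w = v" "p v = w" by (auto simp: doubleton_eq_iff)
      then show False using dp[OF vw(1)] dp[OF vw(2)] by simp
    qed
  qed
  then have "card ((\<lambda>v. {v, p v}) ` (V - {r})) = card (V - {r})" by (rule card_image)
  then show ?thesis using card_Suc_Diff1[OF assms(1,2)] by (simp only:)
qed

lemma (in pair_graph) finite_edges: "finite (edges G)"
proof -
  have "edges G = (\<lambda>(u, v). {u, v}) ` parcs G" by (auto simp: edges_def)
  then show ?thesis using pair_finite_arcs by simp
qed

lemma (in pair_graph) connected_card_verts_le:
  assumes "Digraph_Component.connected (with_proj G)"
  shows "card (pverts G) \<le> Suc (card (edges G))"
proof -
  obtain r where r: "r \<in> pverts G" using assms connected_iff_rtrancl by blast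
  have reach: "(r, v) \<in> (parcs G)\<^sup>*" if "v \<in> pverts G" for v
    using assms r that unfolding connected_iff_rtrancl by blast
  obtain d p
    where dp: "\<And>v. v \<in> pverts G - {r} \<Longrightarrow> (v, p v) \<in> parcs G \<and> d v = Suc (d (p v))"
    using bfs_parents[OF r reach] by blast
  have "(\<lambda>v. {v, p v}) ` (pverts G - {r}) \<subseteq> edges G" using dp unfolding edges_def by blast
  then have "card ((\<lambda>v. {v, p v}) ` (pverts G - {r})) \<le> card (edges G)"
    by (rule card_mono[OF finite_edges])
  moreover have "Suc (card ((\<lambda>v. {v, p v}) ` (pverts G - {r}))) = card (pverts G)"
    by (rule card_parent_edges[OF pair_finite_verts r, of d]) (use dp in blast)
  ultimately show ?thesis by simp
qed

section \<open>Deleting an edge: cycles and bridges\<close>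

definition delete_edge :: "'a pair_pre_digraph \<Rightarrow> 'a \<Rightarrow> 'a \<Rightarrow> 'a pair_pre_digraph" where
  "delete_edge G u v = \<lparr> pverts = pverts G, parcs = parcs G - {(u, v), (v, u)} \<rparr>"

lemma (in pair_graph) pair_graph_delete_edge: "pair_graph (delete_edge G u v)"
proof unfold_locales
  let ?D = "delete_edge G u v"
  show "fst e \<in> pverts ?D" if "e \<in> parcs ?D" for e
    using that arc_fst_in_verts by (simp add: delete_edge_def)
  show "snd e \<in> pverts ?D" if "e \<in> parcs ?D" for e
    using that arc_snd_in_verts by (simp add: delete_edge_def)
  show "finite (pverts ?D)" using pair_finite_verts by (simp add: delete_edge_def)
  show "finite (parcs ?D)" using pair_finite_arcs by (simp add: delete_edge_def)
  show "fst e \<noteq> snd e" if "e \<in> parcs ?D" for e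
    using that pair_no_loops by (simp add: delete_edge_def)
  have "sym (parcs ?D)" by (rule symI) (use arcs_symmetric in \<open>auto simp: delete_edge_def\<close>)
  then show "symmetric (with_proj ?D)" by (simp add: symmetric_def)
qed

lemma (in pair_graph) card_edges_delete_edge:
  assumes "(u, v) \<in> parcs G"
  shows "Suc (card (edges (delete_edge G u v))) = card (edges G)"
proof -
  have "edges (delete_edge G u v) = edges G - {{u, v}}"
  proof (intro equalityI subsetI)
    fix e assume "e \<in> edges G - {{u, v}}"
    then obtain x y where "e = {x, y}" "(x, y) \<in> parcs G" "{x, y} \<noteq> {u, v}"
      by (auto simp: edges_def)
    moreover from this have "(x, y) \<in> parcs (delete_edge G u v)"
      by (auto simp: delete_edge_def insert_commute)
    ultimately show "e \<in> edges (delete_edge G u v)" unfolding edges_def by blast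
  next
    fix e assume "e \<in> edges (delete_edge G u v)"
    then obtain x y where xy: "e = {x, y}" "(x, y) \<in> parcs G" "(x, y) \<noteq> (u, v)" "(x, y) \<noteq> (v, u)"
      unfolding edges_def delete_edge_def by auto
    then have "e \<noteq> {u, v}" by (auto simp: doubleton_eq_iff)
    then show "e \<in> edges G - {{u, v}}" using xy(1,2) unfolding edges_def by blast
  qed
  moreover have "{u, v} \<in> edges G" using assms by (auto simp: edges_def)
  ultimately show ?thesis using card_Suc_Diff1[OF finite_edges] by (simp only:)
qed

text \<open>A path from \<open>u\<close> to \<open>v\<close> that avoids the edge is closed by the
  arc \<open>(v, u)\<close>. The path has at least two arcs, as it is neither empty nor the deleted
  arc, so the cycle has length at least 3.\<close>

lemma (in pair_graph) contains_cycleI: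
  assumes uv: "(u, v) \<in> parcs G" and path: "(u, v) \<in> (parcs (delete_edge G u v))\<^sup>*"
  shows "contains_cycle (with_proj G)"
proof -
  interpret D: pair_graph "delete_edge G u v" by (rule pair_graph_delete_edge)
  have V: "u \<in> pverts G" "v \<in> pverts G" using uv in_arcsD1 in_arcsD2 by auto
  then have "u \<rightarrow>\<^sup>*\<^bsub>with_proj (delete_edge G u v)\<^esub> v"
    using path by (simp add: D.reachable_conv) (simp add: delete_edge_def)
  then obtain p where p: "D.apath u p v" using D.reachable_apath by blast
  have sub: "subgraph (with_proj (delete_edge G u v)) (with_proj G)"
    using wf_digraph_axioms D.wf_digraph_axioms
    by (auto simp: subgraph_def delete_edge_def compatible_def)
  have aw: "awalk u p v" using subgraph_awalk_imp_awalk[OF D.awalkI_apath[OF p] sub] .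
  have dist: "distinct (pawalk_verts u p)" using p by (simp add: D.apath_def)
  have len: "2 \<le> length p"
  proof (rule ccontr)
    assume "\<not> 2 \<le> length p"
    then consider "p = []" | e where "p = [e]" by (cases p; cases "tl p") auto
    then show False
    proof cases
      case 1
      then show False using aw no_loops'[OF uv] by (simp add: awalk_Nil_iff)
    next
      case 2
      then have "e = (u, v)" "e \<in> parcs (delete_edge G u v)"
        using p by (auto simp: D.apath_def D.awalk_Cons_iff D.awalk_Nil_iff)
      then show False by (simp add: delete_edge_def)
    qed
  qed
  have "awalk v ((v, u) # p) v" using aw arcs_symmetric[OF uv] by (simp add: awalk_Cons_iff)
  then have "cycle ((v, u) # p)" unfolding cycle_def using dist by auto
  then show ?thesis unfolding contains_cycle_def using len by (intro exI[of _ "(v, u) # p"]) simp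
qed

text \<open>Adding an edge between vertices that are already linked does not enlarge
  reachability.\<close>

lemma rtrancl_subset_sym_Un:
  assumes "sym S" "(a, b) \<in> S\<^sup>*" "R \<subseteq> S \<union> {(a, b), (b, a)}"
  shows "R\<^sup>* \<subseteq> S\<^sup>*"
proof (rule rtrancl_subset_rtrancl)
  have "(b, a) \<in> S\<^sup>*" using assms(1,2) sym_rtrancl by (metis symD)
  with assms(2,3) show "R \<subseteq> S\<^sup>*" by auto
qed

text \<open>Take the first arc of a cycle. The rest of the cycle links its ends, and it uses neither
  direction of that edge.\<close>

lemma (in pair_graph) cycle_edge_not_bridge:
  assumes "contains_cycle (with_proj G)"
  obtains u v where "(u, v) \<in> parcs G" "(u, v) \<in> (parcs (delete_edge G u v))\<^sup>*"
proof -
  obtain p u where p: "awalk u p u" "distinct (tl (pawalk_verts u p))" "distinct p" "3 \<le> length p"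
    using assms unfolding contains_cycle_def cycle_conv by blast
  obtain e q where pq: "p = e # q" using p(4) by (cases p) auto
  obtain b where e: "e = (u, b)" using p(1) pq by (cases e) (auto simp: awalk_Cons_iff)
  have arc: "(u, b) \<in> parcs G" and q: "awalk b q u" using p(1) pq e by (auto simp: awalk_Cons_iff)
  have dist: "distinct (pawalk_verts b q)" using p(2) pq e by simp
  have nq: "(u, b) \<notin> set q" using p(3) pq e by simp
  \<comment> \<open>The path \<open>q\<close> runs from \<open>b\<close> to \<open>u\<close> without
    repeating a vertex. If it used the arc \<open>(b, u)\<close>, it would consist of this arc
    alone, and the cycle would have length 2.\<close>
  have nr: "(b, u) \<notin> set q"
  proof
    assume "(b, u) \<in> set q"
    then obtain q1 q2 where qq: "q = q1 @ (b, u) # q2" by (auto simp: in_set_conv_decomp)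
    have ap: "apath b q u" using q dist by (simp add: apath_def)
    have "q1 = []"
    proof (rule ccontr)
      assume ne: "q1 \<noteq> []"
      have "awalk b q1 b"
        using q unfolding qq by (auto simp: awalk_append_iff awalk_Cons_iff)
      moreover have "apath b q1 b"
        using ap unfolding qq apath_append_iff by (metis calculation awalk_verts_conv awalk_ends awalkE)
      ultimately show False using ne apath_nonempty_ends by blast
    qed
    moreover have "q2 = []"
    proof (rule ccontr)
      assume ne: "q2 \<noteq> []"
      have "apath u q2 u" using ap unfolding qq \<open>q1 = []\<close> by (simp add: apath_Cons_iff)
      then show False using ne apath_nonempty_ends by blast
    qed
    ultimately show False using p(4) pq qq by simp
  qed
  have "(b, u) \<in> (set q)\<^sup>*" if "awalk b q u" for b u and q :: "('a \<times> 'a) list"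
    using that
  proof (induction q arbitrary: b)
    case (Cons e q)
    then have "(snd e, u) \<in> (set q)\<^sup>*" "fst e = b" by (auto simp: awalk_Cons_iff)
    moreover have "(set q)\<^sup>* \<subseteq> (set (e # q))\<^sup>*" by (rule rtrancl_mono) auto
    ultimately show ?case by (metis converse_rtrancl_into_rtrancl list.set_intros(1) prod.collapse subsetD)
  qed (simp add: awalk_Nil_iff)
  then have "(b, u) \<in> (set q)\<^sup>*" using q .
  moreover have "set q \<subseteq> parcs (delete_edge G b u)"
    using q nq nr by (auto simp: delete_edge_def awalk_def)
  ultimately have "(b, u) \<in> (parcs (delete_edge G b u))\<^sup>*" using rtrancl_mono by blast
  then show thesis using that[of b u] arcs_symmetric[OF arc] by blast
qed

text \<open>Deleting an edge of a cycle keeps the graph connected, so the bound for connected graphs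
  improves by one.\<close>

lemma (in pair_graph) connected_cyclic_card_verts_le:
  assumes conn: "Digraph_Component.connected (with_proj G)" and "contains_cycle (with_proj G)"
  shows "card (pverts G) \<le> card (edges G)"
proof -
  obtain u v where uv: "(u, v) \<in> parcs G" "(u, v) \<in> (parcs (delete_edge G u v))\<^sup>*"
    using cycle_edge_not_bridge[OF assms(2)] .
  interpret D: pair_graph "delete_edge G u v" by (rule pair_graph_delete_edge)
  have "(parcs G)\<^sup>* \<subseteq> (parcs (delete_edge G u v))\<^sup>*"
  proof (rule rtrancl_subset_sym_Un[OF _ uv(2)])
    show "sym (parcs (delete_edge G u v))" using D.arcs_symmetric by (rule symI)
    show "parcs G \<subseteq> parcs (delete_edge G u v) \<union> {(u, v), (v, u)}" by (auto simp: delete_edge_def)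
  qed
  then have "Digraph_Component.connected (with_proj (delete_edge G u v))"
    using conn unfolding connected_iff_rtrancl D.connected_iff_rtrancl by (auto simp: delete_edge_def)
  from D.connected_card_verts_le[OF this] card_edges_delete_edge[OF uv(1)]
  show ?thesis by (simp add: delete_edge_def)
qed

text \<open>In a tree all edges are parent edges of a breadth-first search. Counting them gives the
  first claim, and the parity of the depth gives the bipartition.\<close>

lemma (in pair_graph) tree_card_edges_bipartite:
  assumes conn: "Digraph_Component.connected (with_proj G)" and acyc: "\<not> contains_cycle (with_proj G)"
  shows "Suc (card (edges G)) = card (pverts G)" and "bipartite G"
proof -
  obtain r where r: "r \<in> pverts G" using conn connected_iff_rtrancl by blast
  have reach: "(r, v) \<in> (parcs G)\<^sup>*" if "v \<in> pverts G" for v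
    using conn r that unfolding connected_iff_rtrancl by blast
  obtain d p
    where dp: "\<And>v. v \<in> pverts G - {r} \<Longrightarrow> (v, p v) \<in> parcs G \<and> d v = Suc (d (p v))"
    using bfs_parents[OF r reach] by blast
  let ?F = "(\<lambda>v. {v, p v}) ` (pverts G - {r})"
  \<comment> \<open>If an edge that is not a parent edge is deleted, every vertex still reaches the
    root along parent edges. The ends of the edge stay linked, which yields a cycle.\<close>
  have F: "{u, v} \<in> ?F" if uv: "(u, v) \<in> parcs G" for u v
  proof (rule ccontr)
    assume nF: "{u, v} \<notin> ?F"
    interpret D: pair_graph "delete_edge G u v" by (rule pair_graph_delete_edge)
    have "(w, r) \<in> (parcs (delete_edge G u v))\<^sup>*" if "w \<in> pverts G" for w
      using that
    proof (induction "d w" arbitrary: w rule: less_induct)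
      case less
      show ?case
      proof (cases "w = r")
        case False
        with dp less.prems have w: "(w, p w) \<in> parcs G" "d w = Suc (d (p w))" by blast+
        have "{w, p w} \<in> ?F" using False less.prems by blast
        then have "(w, p w) \<in> parcs (delete_edge G u v)"
          using nF w(1) by (auto simp: delete_edge_def insert_commute)
        moreover have "(p w, r) \<in> (parcs (delete_edge G u v))\<^sup>*"
          by (rule less.hyps) (use w in_arcsD2 in auto)
        ultimately show ?thesis by (rule converse_rtrancl_into_rtrancl)
      qed simp
    qed
    moreover have "sym ((parcs (delete_edge G u v))\<^sup>*)"
      by (rule sym_rtrancl) (use D.arcs_symmetric in \<open>auto intro: symI\<close>)
    ultimately have "(u, v) \<in> (parcs (delete_edge G u v))\<^sup>*"
      using uv in_arcsD1 in_arcsD2 by (meson rtrancl_trans symD)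
    then show False using contains_cycleI[OF uv] acyc by blast
  qed
  have "edges G = ?F"
  proof
    show "edges G \<subseteq> ?F" using F unfolding edges_def by blast
    show "?F \<subseteq> edges G" using dp unfolding edges_def by blast
  qed
  moreover have "Suc (card ?F) = card (pverts G)"
    by (rule card_parent_edges[OF pair_finite_verts r, of d]) (use dp in blast)
  ultimately show "Suc (card (edges G)) = card (pverts G)" by simp
  have par: "even (d u) \<noteq> even (d v)" if uv: "(u, v) \<in> parcs G" for u v
  proof -
    obtain w where w: "w \<in> pverts G - {r}" "{u, v} = {w, p w}" using F[OF uv] by blast
    then have "u = w \<and> v = p w \<or> u = p w \<and> v = w" unfolding doubleton_eq_iff by blast
    moreover have "d w = Suc (d (p w))" using dp w(1) by blast
    ultimately show ?thesis by auto
  qed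
  show "bipartite G" unfolding bipartite_def
    by (rule exI[of _ "{v \<in> pverts G. even (d v)}"], rule exI[of _ "{v \<in> pverts G. odd (d v)}"])
      (use par in_arcsD1 in_arcsD2 in auto)
qed

section \<open>Main eigenvalues\<close>

definition vertex_vec :: "'a pair_pre_digraph \<Rightarrow> ('a \<Rightarrow> real) \<Rightarrow> real vec" where
  "vertex_vec G g = vec (card (pverts G)) (\<lambda>i. g (vertex_list G ! i))"

text \<open>Eigenvectors as functions on vertices. Free of the enumeration, they can be extended by
  zero from a component to the whole graph, although the two vertex lists are unrelated.\<close>

definition eigenfunction :: "'a pair_pre_digraph \<Rightarrow> real \<Rightarrow> ('a \<Rightarrow> real) \<Rightarrow> bool" where
  "eigenfunction G \<mu> g \<longleftrightarrow> (\<exists>u\<in>pverts G. g u \<noteq> 0) \<and>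
     (\<forall>u\<in>pverts G. (\<Sum>w\<in>pverts G. if (u, w) \<in> parcs G then g w else 0) = \<mu> * g u)"

lemma vertex_vec_carrier [simp]: "vertex_vec G g \<in> carrier_vec (card (pverts G))"
  by (simp add: vertex_vec_def)

lemma adjacency_mat_carrier [simp]:
  "adjacency_mat G \<in> carrier_mat (card (pverts G)) (card (pverts G))"
  by (simp add: adjacency_mat_def)

lemma adjacency_mat_dims [simp]:
  "dim_row (adjacency_mat G) = card (pverts G)" "dim_col (adjacency_mat G) = card (pverts G)"
  by (simp_all add: adjacency_mat_def)

lemma vertex_list_complement [simp]: "vertex_list (complement_graph G) = vertex_list G"
  by (simp add: vertex_list_def complement_graph_def)

lemma pverts_complement [simp]: "pverts (complement_graph G) = pverts G"
  by (simp add: complement_graph_def)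

lemma parcs_complement_iff:
  "(u, v) \<in> parcs (complement_graph G) \<longleftrightarrow> u \<in> pverts G \<and> v \<in> pverts G \<and> u \<noteq> v \<and> (u, v) \<notin> parcs G"
  by (simp add: complement_graph_def)

lemma complement_adjacency_mat_carrier [simp]:
  "adjacency_mat (complement_graph G) \<in> carrier_mat (card (pverts G)) (card (pverts G))"
  using adjacency_mat_carrier[of "complement_graph G"] by simp

context pair_graph
begin

lemma vertex_list_props: "distinct (vertex_list G)" "set (vertex_list G) = pverts G"
proof -
  have "\<exists>xs. distinct xs \<and> set xs = pverts G"
    using finite_distinct_list[OF pair_finite_verts] by blast
  then have "distinct (vertex_list G) \<and> set (vertex_list G) = pverts G"
    unfolding vertex_list_def by (rule someI_ex)
  then show "distinct (vertex_list G)" "set (vertex_list G) = pverts G" by auto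
qed

lemma length_vertex_list [simp]: "length (vertex_list G) = card (pverts G)"
  using distinct_card[OF vertex_list_props(1)] vertex_list_props(2) by simp

lemma vertex_list_nth_in [simp]: "i < card (pverts G) \<Longrightarrow> vertex_list G ! i \<in> pverts G"
  using vertex_list_props(2) nth_mem by fastforce

lemma bij_vertex_list: "bij_betw (\<lambda>i. vertex_list G ! i) {..<card (pverts G)} (pverts G)"
  using bij_betw_nth[OF vertex_list_props(1) _ vertex_list_props(2)[symmetric]] by simp

lemma sum_vertex_list: "(\<Sum>i<card (pverts G). h (vertex_list G ! i)) = (\<Sum>v\<in>pverts G. h v)"
  by (rule sum.reindex_bij_betw[OF bij_vertex_list])

lemma vertex_list_obtain:
  assumes "u \<in> pverts G"
  obtains i where "i < card (pverts G)" "u = vertex_list G ! i"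
  using assms vertex_list_props(2) by (metis in_set_conv_nth length_vertex_list)

lemma ball_vertex_list: "(\<forall>u\<in>pverts G. P u) \<longleftrightarrow> (\<forall>i<card (pverts G). P (vertex_list G ! i))"
  by (auto elim!: vertex_list_obtain)

lemma vertex_vec_surj:
  assumes "v \<in> carrier_vec (card (pverts G))"
  obtains g where "v = vertex_vec G g"
proof
  let ?f = "\<lambda>i. vertex_list G ! i" and ?I = "{..<card (pverts G)}"
  show "v = vertex_vec G (\<lambda>u. v $ the_inv_into ?I ?f u)"
    using assms bij_vertex_list
    by (intro eq_vecI) (auto simp: vertex_vec_def bij_betw_def the_inv_into_f_f)
qed

lemma sum_vertex_vec: "(\<Sum>i<card (pverts G). vertex_vec G g $ i) = (\<Sum>v\<in>pverts G. g v)"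
  by (subst sum_vertex_list[symmetric]) (simp add: vertex_vec_def)

lemma vertex_vec_eq_0_iff: "vertex_vec G g = 0\<^sub>v (card (pverts G)) \<longleftrightarrow> (\<forall>u\<in>pverts G. g u = 0)"
proof
  assume eq: "vertex_vec G g = 0\<^sub>v (card (pverts G))"
  show "\<forall>u\<in>pverts G. g u = 0"
  proof
    fix u assume "u \<in> pverts G"
    then obtain i where i: "i < card (pverts G)" "u = vertex_list G ! i" by (rule vertex_list_obtain)
    then show "g u = 0" using arg_cong[OF eq, of "\<lambda>v. v $ i"] by (simp add: vertex_vec_def)
  qed
qed (auto simp: vertex_vec_def intro!: eq_vecI)

lemma adjacency_mat_mult_vertex_vec:
  assumes "i < card (pverts G)"
  shows "(adjacency_mat G *\<^sub>v vertex_vec G g) $ i =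
    (\<Sum>w\<in>pverts G. if (vertex_list G ! i, w) \<in> parcs G then g w else 0)"
  by (subst sum_vertex_list[symmetric])
    (use assms in \<open>auto simp: adjacency_mat_def vertex_vec_def scalar_prod_def lessThan_atLeast0 intro!: sum.cong\<close>)

lemma eigenvector_vertex_vec:
  "eigenvector (adjacency_mat G) (vertex_vec G g) \<mu> \<longleftrightarrow> eigenfunction G \<mu> g"
proof -
  have "adjacency_mat G *\<^sub>v vertex_vec G g = \<mu> \<cdot>\<^sub>v vertex_vec G g \<longleftrightarrow>
      (\<forall>i<card (pverts G). (adjacency_mat G *\<^sub>v vertex_vec G g) $ i = \<mu> * g (vertex_list G ! i))"
    by (auto simp: vec_eq_iff vertex_vec_def)
  also have "\<dots> \<longleftrightarrow> (\<forall>u\<in>pverts G. (\<Sum>w\<in>pverts G. if (u, w) \<in> parcs G then g w else 0) = \<mu> * g u)"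
    unfolding ball_vertex_list by (rule all_cong) (simp only: adjacency_mat_mult_vertex_vec)
  finally have eq: "adjacency_mat G *\<^sub>v vertex_vec G g = \<mu> \<cdot>\<^sub>v vertex_vec G g \<longleftrightarrow>
      (\<forall>u\<in>pverts G. (\<Sum>w\<in>pverts G. if (u, w) \<in> parcs G then g w else 0) = \<mu> * g u)" .
  show ?thesis
    unfolding eigenvector_def eigenfunction_def adjacency_mat_dims eq vertex_vec_eq_0_iff by simp
qed

lemma main_eigenvalue_iff_eigenfunction:
  "main_eigenvalue G \<mu> \<longleftrightarrow> (\<exists>g. eigenfunction G \<mu> g \<and> (\<Sum>v\<in>pverts G. g v) \<noteq> 0)"
proof -
  have s: "vertex_vec G g \<bullet> vec (card (pverts G)) (\<lambda>_. 1) = (\<Sum>v\<in>pverts G. g v)" for g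
    by (subst sum_vertex_vec[symmetric]) (simp add: scalar_prod_def lessThan_atLeast0)
  show ?thesis
  proof
    assume "main_eigenvalue G \<mu>"
    then obtain v where v: "eigenvector (adjacency_mat G) v \<mu>"
        "v \<bullet> vec (card (pverts G)) (\<lambda>_. 1) \<noteq> 0" unfolding main_eigenvalue_def by blast
    have "v \<in> carrier_vec (card (pverts G))"
      using v(1) unfolding eigenvector_def by auto
    then obtain g where "v = vertex_vec G g" by (rule vertex_vec_surj)
    then show "\<exists>g. eigenfunction G \<mu> g \<and> (\<Sum>v\<in>pverts G. g v) \<noteq> 0"
      using v s eigenvector_vertex_vec by auto
  next
    assume "\<exists>g. eigenfunction G \<mu> g \<and> (\<Sum>v\<in>pverts G. g v) \<noteq> 0"
    then show "main_eigenvalue G \<mu>"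
      unfolding main_eigenvalue_def using s eigenvector_vertex_vec by fastforce
  qed
qed

lemma adjacency_mat_sym:
  assumes "i < card (pverts G)" "j < card (pverts G)"
  shows "adjacency_mat G $$ (i, j) = adjacency_mat G $$ (j, i)"
  using assms arcs_symmetric by (auto simp: adjacency_mat_def)

section \<open>The complement, and the comparison of its eigenspaces with those of the graph\<close>

lemma pair_graph_complement: "pair_graph (complement_graph G)"
proof unfold_locales
  let ?D = "complement_graph G"
  show "fst e \<in> pverts ?D" "snd e \<in> pverts ?D" if "e \<in> parcs ?D" for e
    using that by (auto simp: complement_graph_def)
  show "finite (pverts ?D)" using pair_finite_verts by simp
  have "parcs ?D \<subseteq> pverts G \<times> pverts G" by (auto simp: complement_graph_def)
  then show "finite (parcs ?D)" using pair_finite_verts by (meson finite_SigmaI finite_subset)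
  show "fst e \<noteq> snd e" if "e \<in> parcs ?D" for e
    using that by (auto simp: complement_graph_def)
  have "sym (parcs ?D)" by (rule symI) (use arcs_symmetric in \<open>auto simp: complement_graph_def\<close>)
  then show "symmetric (with_proj ?D)" by (simp add: symmetric_def)
qed

lemma adjacency_mat_complement:
  assumes "i < card (pverts G)" "j < card (pverts G)"
  shows "adjacency_mat (complement_graph G) $$ (i, j) =
    (1 - (if i = j then 1 else 0) - adjacency_mat G $$ (i, j) :: real)"
proof -
  have "vertex_list G ! i = vertex_list G ! j \<longleftrightarrow> i = j"
    using assms nth_eq_iff_index_eq[OF vertex_list_props(1)] by simp
  moreover have "(vertex_list G ! j, vertex_list G ! j) \<notin> parcs G" using no_loops' by blast
  ultimately show ?thesis
    using assms by (auto simp: adjacency_mat_def parcs_complement_iff)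
qed

lemma char_matrix_adjacency_index:
  fixes v :: "real vec" and x :: real
  assumes "v \<in> carrier_vec (card (pverts G))" "i < card (pverts G)"
  shows "(char_matrix (adjacency_mat G) x *\<^sub>v v) $ i =
    (\<Sum>j<card (pverts G). adjacency_mat G $$ (i, j) * v $ j) - x * v $ i"
proof -
  let ?n = "card (pverts G)"
  have "(char_matrix (adjacency_mat G) x *\<^sub>v v) $ i =
      (\<Sum>j<?n. adjacency_mat G $$ (i, j) * v $ j - (if i = j then x * v $ j else 0))"
    using assms
    by (auto simp: char_matrix_def scalar_prod_def lessThan_atLeast0 algebra_simps intro!: sum.cong)
  then show ?thesis using assms(2) by (simp add: sum_subtractf)
qed

text \<open>The value \<open>-1 - x\<close> cancels the identity matrix:
  \<open>(J - 1 - A) - (-1 - x) = J - (A - x)\<close>, with \<open>J\<close> the all-one matrix and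
  scalars read as multiples of the identity.\<close>

lemma char_matrix_complement_index:
  fixes v :: "real vec" and x :: real
  assumes "v \<in> carrier_vec (card (pverts G))" "i < card (pverts G)"
  shows "(char_matrix (adjacency_mat (complement_graph G)) (- 1 - x) *\<^sub>v v) $ i =
    (\<Sum>j<card (pverts G). v $ j) - (char_matrix (adjacency_mat G) x *\<^sub>v v) $ i"
proof -
  let ?n = "card (pverts G)"
  interpret C: pair_graph "complement_graph G" by (rule pair_graph_complement)
  have "(char_matrix (adjacency_mat (complement_graph G)) (- 1 - x) *\<^sub>v v) $ i =
      (\<Sum>j<?n. adjacency_mat (complement_graph G) $$ (i, j) * v $ j) - (- 1 - x) * v $ i"
    using C.char_matrix_adjacency_index[of v i "- 1 - x"] assms by simp
  also have "(\<Sum>j<?n. adjacency_mat (complement_graph G) $$ (i, j) * v $ j) =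
      (\<Sum>j<?n. v $ j - (if i = j then v $ j else 0) - adjacency_mat G $$ (i, j) * v $ j)"
    using assms by (intro sum.cong) (auto simp: adjacency_mat_complement algebra_simps)
  also have "\<dots> = (\<Sum>j<?n. v $ j) - v $ i - (\<Sum>j<?n. adjacency_mat G $$ (i, j) * v $ j)"
    using assms by (simp add: sum_subtractf)
  finally show ?thesis
    using char_matrix_adjacency_index[OF assms, of x] by (simp add: algebra_simps)
qed

lemma char_poly_adjacency_splits:
  "char_poly (adjacency_mat G :: real mat) = (\<Prod>a\<in>#adjacency_spectrum G. [:- a, 1:])"
  unfolding adjacency_spectrum_def
  by (rule symmetric_char_poly_proots(1)[OF adjacency_mat_carrier adjacency_mat_sym])

lemma size_adjacency_spectrum: "size (adjacency_spectrum G) = card (pverts G)"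
  unfolding adjacency_spectrum_def
  by (rule symmetric_char_poly_proots(2)[OF adjacency_mat_carrier adjacency_mat_sym])

lemma sum_diag_pow_adjacency:
  "(\<Sum>i<card (pverts G). (adjacency_mat G ^\<^sub>m k) $$ (i, i)) = (\<Sum>a\<in>#adjacency_spectrum G. a ^ k)"
  unfolding adjacency_spectrum_def
  by (rule symmetric_sum_diag_pow[OF adjacency_mat_carrier adjacency_mat_sym])

lemma char_poly_adjacency_nonzero: "char_poly (adjacency_mat G :: real mat) \<noteq> 0"
  using degree_monic_char_poly[of "adjacency_mat G :: real mat", OF adjacency_mat_carrier] by auto

lemma count_adjacency_spectrum:
  "count (adjacency_spectrum G) x = Polynomial.order x (char_poly (adjacency_mat G))"
  unfolding adjacency_spectrum_def using char_poly_adjacency_nonzero by simp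

lemma order_char_poly_adjacency:
  fixes x :: real
  shows   "Polynomial.order x (char_poly (adjacency_mat G)) = kernel_dim (char_matrix (adjacency_mat G) x)"
  by (rule symmetric_order_char_poly[OF adjacency_mat_carrier adjacency_mat_sym])

lemma mat_kernel_char_matrix_iff:
  fixes x :: real
  shows "v \<in> mat_kernel (char_matrix (adjacency_mat G) x) \<longleftrightarrow>
    v \<in> carrier_vec (card (pverts G)) \<and>
    (\<forall>i<card (pverts G). (char_matrix (adjacency_mat G) x *\<^sub>v v) $ i = 0)"
  unfolding mat_kernel[OF char_matrix_closed[OF adjacency_mat_carrier]]
  by (auto simp: vec_eq_iff char_matrix_def)

text \<open>A vector with nonzero coordinate sum is nonzero, so it is an eigenvector as soon as it
  lies in the kernel.\<close>

lemma main_eigenvalue_iff_kernel: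
  "main_eigenvalue G x \<longleftrightarrow>
    (\<exists>v\<in>mat_kernel (char_matrix (adjacency_mat G) x). (\<Sum>i<card (pverts G). v $ i) \<noteq> 0)"
proof -
  have s: "v \<bullet> vec (card (pverts G)) (\<lambda>_. 1) = (\<Sum>i<card (pverts G). v $ i)" for v :: "real vec"
    by (simp add: scalar_prod_def lessThan_atLeast0)
  have z: "(\<Sum>i<card (pverts G). v $ i) = 0" if "v = 0\<^sub>v (card (pverts G))" for v :: "real vec"
    using that by simp
  show ?thesis
    unfolding main_eigenvalue_def s eigenvector_char_matrix[OF adjacency_mat_carrier]
      mat_kernel[OF char_matrix_closed[OF adjacency_mat_carrier]]
    using z by blast
qed

text \<open>
  An eigenvector of the complement for \<open>-1 - x\<close> satisfies \<open>(A - x) v = (1 \<bullet> v) 1\<close>. If \<open>x\<close> is main,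
  pairing with an eigenvector of \<open>A\<close> that is not orthogonal to \<open>1\<close> forces \<open>1 \<bullet> v = 0\<close>, so the
  eigenspace of the complement is a proper subspace of that of \<open>A\<close>.
\<close>

lemma main_eigenvalue_iff_order:
  "main_eigenvalue G x \<longleftrightarrow>
    Polynomial.order (- 1 - x) (char_poly (adjacency_mat (complement_graph G)))
      < Polynomial.order x (char_poly (adjacency_mat G))"
proof -
  let ?n = "card (pverts G)"
  let ?B = "char_matrix (adjacency_mat G) x" and ?C = "char_matrix (adjacency_mat (complement_graph G)) (- 1 - x)"
  let ?s = "\<lambda>v :: real vec. \<Sum>i<?n. v $ i"
  interpret C: pair_graph "complement_graph G" by (rule pair_graph_complement)
  have B: "?B \<in> carrier_mat ?n ?n" and C: "?C \<in> carrier_mat ?n ?n" by simp_all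
  have kC: "v \<in> mat_kernel ?C \<longleftrightarrow> v \<in> carrier_vec ?n \<and> (\<forall>i<?n. (?B *\<^sub>v v) $ i = ?s v)" for v
    unfolding C.mat_kernel_char_matrix_iff using char_matrix_complement_index[of v _ x] by auto
  note kB = mat_kernel_char_matrix_iff[of _ x]
  \<comment> \<open>If \<open>x\<close> is not main, every vector in the kernel of \<open>?B\<close>
    has coordinate sum 0 and so lies in the kernel of \<open>?C\<close>.\<close>
  have le: "kernel_dim ?B \<le> kernel_dim ?C" if "\<not> main_eigenvalue G x"
  proof -
    have "mat_kernel ?B \<subseteq> mat_kernel ?C"
    proof
      fix v assume v: "v \<in> mat_kernel ?B"
      then have "?s v = 0" using that unfolding main_eigenvalue_iff_kernel by blast
      with v show "v \<in> mat_kernel ?C" unfolding kB kC by simp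
    qed
    moreover obtain S where "S \<subseteq> mat_kernel ?B" "indep ?n S" "card S = kernel_dim ?B"
      using kernel_dim_indep[OF B] .
    ultimately show ?thesis using indep_card_le_kernel_dim[OF C, of S] by auto
  qed
  have less: "kernel_dim ?C < kernel_dim ?B" if main: "main_eigenvalue G x"
  proof -
    obtain w where w: "w \<in> mat_kernel ?B" "?s w \<noteq> 0" using main unfolding main_eigenvalue_iff_kernel by blast
    obtain S where S: "S \<subseteq> mat_kernel ?C" "indep ?n S" "card S = kernel_dim ?C"
      using kernel_dim_indep[OF C] .
    have S0: "?s v = 0" and SB: "v \<in> mat_kernel ?B" if "v \<in> S" for v
    proof -
      have v: "v \<in> carrier_vec ?n" "\<And>i. i < ?n \<Longrightarrow> (?B *\<^sub>v v) $ i = ?s v" using S(1) that unfolding kC by (simp_all add: kC subset_iff)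
      have wc: "w \<in> carrier_vec ?n" and wB: "?B *\<^sub>v w = 0\<^sub>v ?n"
        using w(1) mat_kernel[OF B] by auto
      have sym: "?B $$ (i, j) = ?B $$ (j, i)" if "i < ?n" "j < ?n" for i j
        using that adjacency_mat_sym[OF that] by (auto simp: char_matrix_def)
      have "w \<bullet> (?B *\<^sub>v v) = (?B *\<^sub>v w) \<bullet> v"
        by (rule symmetric_scalar_prod_mult_mat_vec[OF B sym wc v(1)])
      also have "\<dots> = 0" using wB v(1) by simp
      finally have "0 = w \<bullet> (?B *\<^sub>v v)" by simp
      also have "\<dots> = (\<Sum>i<?n. w $ i * (?B *\<^sub>v v) $ i)"
        using carrier_matD[OF B] by (simp add: scalar_prod_def lessThan_atLeast0 del: index_mult_mat_vec)
      also have "\<dots> = ?s w * ?s v" by (simp add: v(2) sum_distrib_right del: index_mult_mat_vec)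
      finally show s0: "?s v = 0" using w(2) by simp
      show "v \<in> mat_kernel ?B" using v s0 unfolding kB by simp
    qed
    have wS: "w \<notin> S" using S0 w(2) by blast
    have fin: "finite S" using S(2) by (simp add: indep_def)
    \<comment> \<open>Summing the coordinates of a linear relation removes the vectors of
      \<open>S\<close> and isolates the coefficient of \<open>w\<close>. This extra independent
      vector makes the inequality strict.\<close>
    have "indep ?n (insert w S)"
      unfolding indep_def
    proof (intro conjI allI impI)
      show "insert w S \<subseteq> carrier_vec ?n" using S(2) w(1) unfolding kB indep_def by simp
      fix a assume lin: "\<forall>i<?n. (\<Sum>x\<in>insert w S. a x * x $ i) = 0"
      have "0 = (\<Sum>i<?n. \<Sum>x\<in>insert w S. a x * x $ i)" using lin by simp
      also have "\<dots> = (\<Sum>x\<in>insert w S. a x * ?s x)" by (subst sum.swap) (simp add: sum_distrib_left)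
      also have "\<dots> = a w * ?s w" using fin wS S0 by simp
      finally have aw: "a w = 0" using w(2) by simp
      with lin fin wS have "\<forall>i<?n. (\<Sum>x\<in>S. a x * x $ i) = 0" by simp
      then have "\<forall>x\<in>S. a x = 0" using S(2) by (simp add: indep_def)
      with aw show "\<forall>x\<in>insert w S. a x = 0" by simp
    qed (use fin in simp)
    moreover have "insert w S \<subseteq> mat_kernel ?B" using w(1) SB by blast
    ultimately have "card (insert w S) \<le> kernel_dim ?B" using indep_card_le_kernel_dim[OF B] by blast
    then show ?thesis using fin wS S(3) by simp
  qed
  show ?thesis
    unfolding order_char_poly_adjacency C.order_char_poly_adjacency using le less by (meson linorder_not_less)
qed

lemma sum_adjacency_spectrum: "(\<Sum>a\<in>#adjacency_spectrum G. a) = 0"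
proof -
  have "(vertex_list G ! i, vertex_list G ! i) \<notin> parcs G" for i using no_loops' by blast
  then have "(\<Sum>i<card (pverts G). (adjacency_mat G ^\<^sub>m 1) $$ (i, i)) = (0 :: real)"
    by (intro sum.neutral) (auto simp: adjacency_mat_def)
  then show ?thesis unfolding sum_diag_pow_adjacency by simp
qed

text \<open>Without main eigenvalues the spectrum would be contained in the reflected spectrum of
  the complement. Both have the same size, so they would be equal, but their sums are 0 and minus
  the number of vertices.\<close>

lemma exists_main_eigenvalue:
  assumes "pverts G \<noteq> {}"
  shows "\<exists>x. main_eigenvalue G x"
proof (rule ccontr)
  assume none: "\<nexists>x. main_eigenvalue G x"
  interpret C: pair_graph "complement_graph G" by (rule pair_graph_complement)
  let ?S = "adjacency_spectrum G" and ?T = "image_mset (\<lambda>x. - 1 - x) (adjacency_spectrum (complement_graph G))"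
  have "count ?S x \<le> count ?T x" for x
  proof -
    have "count (image_mset (\<lambda>x. - 1 - x) M) x = count M (- 1 - x)" for M :: "real multiset"
      by (induction M) auto
    then show ?thesis
      using none main_eigenvalue_iff_order[of x] count_adjacency_spectrum[of x]
        C.count_adjacency_spectrum[of "- 1 - x"] by simp
  qed
  then have "?S \<subseteq># ?T" by (rule mset_subset_eqI)
  moreover have "size ?S = size ?T" using size_adjacency_spectrum C.size_adjacency_spectrum by simp
  ultimately have "?S = ?T" by (metis mset_subset_size subset_mset.less_le nat_neq_iff)
  then have "0 = (\<Sum>a\<in>#?T. a)" using sum_adjacency_spectrum by simp
  also have "\<dots> = - real (card (pverts G))"
  proof -
    have "(\<Sum>a\<in>#M. - 1 - a) = - real (size M) - (\<Sum>a\<in>#M. a)" for M :: "real multiset"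
      by (induction M) auto
    then show ?thesis using C.sum_adjacency_spectrum C.size_adjacency_spectrum
      by (simp add: multiset.map_comp comp_def)
  qed
  finally show False using assms pair_finite_verts by simp
qed

section \<open>Main eigenvalues and rational irreducible factors\<close>

lemma char_poly_adjacency_of_rat:
  "char_poly (adjacency_mat G :: real mat) = map_poly of_rat (char_poly (adjacency_mat G))"
proof -
  have "adjacency_mat G = map_mat real_of_rat (adjacency_mat G)"
    by (rule eq_matI) (auto simp: adjacency_mat_def)
  then show ?thesis using of_rat_hom.char_poly_hom[OF adjacency_mat_carrier, of G] by metis
qed

text \<open>Orders at \<open>x\<close> are multiplicities of \<open>f\<close>. The right-hand side
  does not mention \<open>x\<close>, so either all real roots of \<open>f\<close> are main or none
  is.\<close>

lemma main_eigenvalue_iff_multiplicity: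
  fixes f :: "rat poly" and x :: real
  assumes f: "irreducible f" "poly (map_poly of_rat f) x = 0"
  shows "main_eigenvalue G x \<longleftrightarrow>
    multiplicity f (pcompose (char_poly (adjacency_mat (complement_graph G))) [:- 1, - 1:])
      < multiplicity f (char_poly (adjacency_mat G))"
proof -
  interpret C: pair_graph "complement_graph G" by (rule pair_graph_complement)
  let ?p = "char_poly (adjacency_mat G) :: rat poly"
  let ?q = "char_poly (adjacency_mat (complement_graph G)) :: rat poly"
  have p0: "?p \<noteq> 0" and q0: "?q \<noteq> 0"
    using char_poly_adjacency_nonzero C.char_poly_adjacency_nonzero
    unfolding char_poly_adjacency_of_rat C.char_poly_adjacency_of_rat by auto
  have "pcompose ?q [:- 1, - 1:] \<noteq> 0" using q0 by (simp add: pcompose_eq_0_iff)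
  then have "multiplicity f (pcompose ?q [:- 1, - 1:]) =
      Polynomial.order x (map_poly of_rat (pcompose ?q [:- 1, - 1:]))"
    by (rule order_eq_multiplicity[OF f, symmetric])
  also have "map_poly of_rat (pcompose ?q [:- 1, - 1:]) =
      pcompose (map_poly of_rat ?q) [:- 1, - 1 :: real:]"
    by (simp add: of_rat_hom.map_poly_pcompose)
  also have "Polynomial.order x \<dots> = Polynomial.order (- 1 - x) (map_poly of_rat ?q)"
    by (rule order_pcompose_reflect) (use q0 in simp)
  finally show ?thesis
    unfolding main_eigenvalue_iff_order char_poly_adjacency_of_rat C.char_poly_adjacency_of_rat
    using order_eq_multiplicity[OF f p0] by simp
qed

lemma main_eigenvalue_root:
  assumes "main_eigenvalue G x"
  shows "poly (char_poly (adjacency_mat G)) x = 0"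
  using assms eigenvalue_root_char_poly[OF adjacency_mat_carrier, of G x]
  unfolding main_eigenvalue_def eigenvalue_def by blast

lemma finite_main_eigenvalues: "finite {x. main_eigenvalue G x}"
  by (rule finite_subset[OF _ poly_roots_finite[OF char_poly_adjacency_nonzero]])
    (use main_eigenvalue_root in auto)

text \<open>All real roots of \<open>f\<close> are main because \<open>x\<close> is, and they are
  simple. Since \<open>f\<close> divides a characteristic polynomial that splits over the reals,
  divisibility can be read off from the roots.\<close>

lemma main_eigenvalue_factor_dvd_main_poly:
  fixes f :: "rat poly" and x :: real
  assumes f: "irreducible f" "poly (map_poly of_rat f) x = 0" and x: "main_eigenvalue G x"
  shows "f dvd char_poly (adjacency_mat G)" "map_poly of_rat f dvd main_poly G"
proof -
  have "0 < multiplicity f (char_poly (adjacency_mat G))"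
    using main_eigenvalue_iff_multiplicity[OF f] x by simp
  then show dvd: "f dvd char_poly (adjacency_mat G)"
    using not_dvd_imp_multiplicity_0 by fastforce
  then obtain g where "char_poly (adjacency_mat G) = f * g" by (rule dvdE)
  then have "map_poly of_rat f dvd char_poly (adjacency_mat G :: real mat)"
    unfolding char_poly_adjacency_of_rat by (simp add: map_poly_of_rat_mult)
  then have "map_poly of_rat f dvd (\<Prod>a\<in>#adjacency_spectrum G. [:- a, 1:])"
    unfolding char_poly_adjacency_splits .
  then show "map_poly of_rat f dvd main_poly G"
  proof (rule dvd_if_simple_roots)
    fix y assume y: "poly (map_poly of_rat f) y = (0 :: real)"
    have "main_eigenvalue G y"
      using main_eigenvalue_iff_multiplicity[OF f] main_eigenvalue_iff_multiplicity[OF f(1) y] x by blast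
    then have "poly (main_poly G) y = 0"
      unfolding main_poly_def poly_prod using finite_main_eigenvalues by (auto simp: prod_zero_iff)
    then show "Polynomial.order y (map_poly of_rat f) = 1 \<and> poly (main_poly G) y = 0"
      using irreducible_order_root[OF f(1) y] by blast
  qed
qed

end

section \<open>Closed walks and the spectrum\<close>

text \<open>The spectrum has one entry per vertex and lists the roots of the split real polynomial.
  The embedding of the rationals is injective on coefficients.\<close>

lemma cospectral_char_poly_eq:
  assumes "pair_graph G" "pair_graph H" and eq: "adjacency_spectrum G = adjacency_spectrum H"
  shows "card (pverts G) = card (pverts H)"
    and "char_poly (adjacency_mat G :: rat mat) = char_poly (adjacency_mat H)"
proof -
  interpret G: pair_graph G by fact
  interpret H: pair_graph H by fact
  show "card (pverts G) = card (pverts H)"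
    using G.size_adjacency_spectrum H.size_adjacency_spectrum eq by simp
  have "char_poly (adjacency_mat G :: real mat) = char_poly (adjacency_mat H)"
    unfolding G.char_poly_adjacency_splits H.char_poly_adjacency_splits eq ..
  then have m: "map_poly real_of_rat (char_poly (adjacency_mat G)) = map_poly of_rat (char_poly (adjacency_mat H))"
    unfolding G.char_poly_adjacency_of_rat H.char_poly_adjacency_of_rat .
  show "char_poly (adjacency_mat G :: rat mat) = char_poly (adjacency_mat H)"
  proof (rule poly_eqI)
    fix k
    have "real_of_rat (coeff (char_poly (adjacency_mat G)) k) = of_rat (coeff (char_poly (adjacency_mat H)) k)"
      using arg_cong[OF m, of "\<lambda>p. coeff p k"] by (simp only: coeff_map_poly of_rat_0)
    then show "coeff (char_poly (adjacency_mat G) :: rat poly) k = coeff (char_poly (adjacency_mat H)) k"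
      by (simp only: of_rat_eq_iff)
  qed
qed

context pair_graph
begin

text \<open>Only the sign of the number of walks is tracked. A sum of nonnegative terms is positive
  iff some term is, which matches the composition in \<open>^^\<close>.\<close>

lemma adjacency_mat_pow_index:
  assumes "i < card (pverts G)" "j < card (pverts G)"
  shows "(adjacency_mat G ^\<^sub>m k) $$ (i, j) \<ge> (0 :: real) \<and>
    ((adjacency_mat G ^\<^sub>m k) $$ (i, j) > (0 :: real) \<longleftrightarrow>
      (vertex_list G ! i, vertex_list G ! j) \<in> parcs G ^^ k)"
  using assms
proof (induction k arbitrary: j)
  case 0
  then show ?case using nth_eq_iff_index_eq[OF vertex_list_props(1)] by simp
next
  case (Suc k)
  let ?n = "card (pverts G)" and ?x = "\<lambda>i. vertex_list G ! i"
  let ?P = "adjacency_mat G ^\<^sub>m k :: real mat" and ?A = "adjacency_mat G :: real mat"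
  have P: "?P \<in> carrier_mat ?n ?n" by simp
  have eq: "(adjacency_mat G ^\<^sub>m Suc k) $$ (i, j) = (\<Sum>l<?n. ?P $$ (i, l) * ?A $$ (l, j))"
    using Suc.prems carrier_matD[OF P] by (simp add: scalar_prod_def lessThan_atLeast0)
  have A: "?A $$ (l, j) = (if (?x l, ?x j) \<in> parcs G then 1 else 0)" if "l < ?n" for l
    using that Suc.prems by (simp add: adjacency_mat_def)
  have nonneg: "?P $$ (i, l) * ?A $$ (l, j) \<ge> 0" if "l < ?n" for l
    using Suc.IH[OF Suc.prems(1) that] A[OF that] by simp
  have "(\<Sum>l<?n. ?P $$ (i, l) * ?A $$ (l, j)) > 0 \<longleftrightarrow> (\<exists>l<?n. ?P $$ (i, l) * ?A $$ (l, j) > 0)"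
  proof
    assume pos: "(\<Sum>l<?n. ?P $$ (i, l) * ?A $$ (l, j)) > 0"
    show "\<exists>l<?n. ?P $$ (i, l) * ?A $$ (l, j) > 0"
    proof (rule ccontr)
      assume "\<not> ?thesis"
      then have "(\<Sum>l<?n. ?P $$ (i, l) * ?A $$ (l, j)) \<le> 0"
        by (intro sum_nonpos) (meson lessThan_iff not_less)
      with pos show False by simp
    qed
  next
    assume "\<exists>l<?n. ?P $$ (i, l) * ?A $$ (l, j) > 0"
    then obtain l where "l < ?n" "?P $$ (i, l) * ?A $$ (l, j) > 0" by blast
    then show "(\<Sum>l<?n. ?P $$ (i, l) * ?A $$ (l, j)) > 0"
      using nonneg by (intro sum_pos2[of _ l]) auto
  qed
  also have "\<dots> \<longleftrightarrow> (\<exists>l<?n. (?x i, ?x l) \<in> parcs G ^^ k \<and> (?x l, ?x j) \<in> parcs G)"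
  proof -
    have "?P $$ (i, l) * ?A $$ (l, j) > 0 \<longleftrightarrow> (?x i, ?x l) \<in> parcs G ^^ k \<and> (?x l, ?x j) \<in> parcs G"
      if "l < ?n" for l
      using Suc.IH[OF Suc.prems(1) that] A[OF that] by simp
    then show ?thesis by blast
  qed
  also have "\<dots> \<longleftrightarrow> (?x i, ?x j) \<in> parcs G ^^ Suc k"
  proof
    assume "(?x i, ?x j) \<in> parcs G ^^ Suc k"
    then obtain w where w: "(?x i, w) \<in> parcs G ^^ k" "(w, ?x j) \<in> parcs G" by auto
    obtain l where "l < ?n" "w = ?x l" using vertex_list_obtain[OF in_arcsD1[OF w(2)]] .
    with w show "\<exists>l<?n. (?x i, ?x l) \<in> parcs G ^^ k \<and> (?x l, ?x j) \<in> parcs G" by blast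
  qed auto
  finally show ?case unfolding eq using nonneg by (auto intro!: sum_nonneg)
qed

text \<open>The power sum is a trace with nonnegative terms, so it vanishes iff every diagonal entry
  does.\<close>

lemma sum_spectrum_power_eq_0_iff:
  "(\<Sum>a\<in>#adjacency_spectrum G. a ^ k) = 0 \<longleftrightarrow> (\<forall>v\<in>pverts G. (v, v) \<notin> parcs G ^^ k)"
proof -
  have "(\<Sum>a\<in>#adjacency_spectrum G. a ^ k) = 0 \<longleftrightarrow>
      (\<forall>i<card (pverts G). (adjacency_mat G ^\<^sub>m k) $$ (i, i) = (0 :: real))"
    unfolding sum_diag_pow_adjacency[symmetric]
    by (subst sum_nonneg_eq_0_iff) (use adjacency_mat_pow_index in auto)
  also have "\<dots> \<longleftrightarrow> (\<forall>i<card (pverts G). (vertex_list G ! i, vertex_list G ! i) \<notin> parcs G ^^ k)"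
  proof (rule all_cong)
    fix i assume "i < card (pverts G)"
    then show "(adjacency_mat G ^\<^sub>m k) $$ (i, i) = (0 :: real) \<longleftrightarrow>
        (vertex_list G ! i, vertex_list G ! i) \<notin> parcs G ^^ k"
      using adjacency_mat_pow_index[of i i k] by linarith
  qed
  finally show ?thesis unfolding ball_vertex_list .
qed

text \<open>The matrix is symmetric with entries 0 and 1, so the diagonal of its square consists of
  the row sums, the vertex degrees.\<close>

lemma sum_spectrum_square: "(\<Sum>a\<in>#adjacency_spectrum G. a ^ 2) = real (card (parcs G))"
proof -
  let ?n = "card (pverts G)" and ?A = "adjacency_mat G :: real mat"
  have A2: "(?A ^\<^sub>m 2) $$ (i, i) = (\<Sum>j<?n. ?A $$ (i, j))" if "i < ?n" for i
  proof -
    have "(?A ^\<^sub>m 2) $$ (i, i) = (\<Sum>j<?n. ?A $$ (i, j) * ?A $$ (j, i))"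
      using that by (simp add: numeral_2_eq_2 scalar_prod_def lessThan_atLeast0)
    also have "\<dots> = (\<Sum>j<?n. ?A $$ (i, j))"
      using that adjacency_mat_sym[OF that] arcs_symmetric by (intro sum.cong) (auto simp: adjacency_mat_def)
    finally show ?thesis .
  qed
  have "(\<Sum>a\<in>#adjacency_spectrum G. a ^ 2) = (\<Sum>i<?n. \<Sum>j<?n. ?A $$ (i, j))"
    unfolding sum_diag_pow_adjacency[symmetric] by (simp add: A2)
  also have "\<dots> = (\<Sum>i<?n. \<Sum>w\<in>pverts G. if (vertex_list G ! i, w) \<in> parcs G then 1 else 0)"
    by (subst sum_vertex_list[symmetric]) (simp add: adjacency_mat_def)
  also have "\<dots> = (\<Sum>u\<in>pverts G. \<Sum>w\<in>pverts G. if (u, w) \<in> parcs G then 1 else 0)"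
    by (rule sum_vertex_list)
  also have "\<dots> = (\<Sum>e\<in>pverts G \<times> pverts G. if e \<in> parcs G then 1 else 0)"
    by (simp add: sum.cartesian_product case_prod_unfold)
  also have "\<dots> = real (card (parcs G))"
  proof -
    have "(pverts G \<times> pverts G) \<inter> parcs G = parcs G" using in_arcsD1 in_arcsD2 by auto
    then show ?thesis using pair_finite_verts by (simp add: sum.If_cases)
  qed
  finally show ?thesis .
qed

lemma card_parcs: "card (parcs G) = 2 * card (edges G)"
proof -
  have fib: "{p \<in> parcs G. {fst p, snd p} = e} = {(u, v), (v, u)}"
    if "(u, v) \<in> parcs G" "e = {u, v}" for u v e
    using that arcs_symmetric[OF that(1)] by (auto simp: doubleton_eq_iff)
  have two: "card {p \<in> parcs G. {fst p, snd p} = e} = 2" if e: "e \<in> edges G" for e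
  proof -
    obtain u v where uv: "(u, v) \<in> parcs G" "e = {u, v}" using e unfolding edges_def by blast
    then show ?thesis unfolding fib[OF uv] using no_loops'[OF uv(1)] by simp
  qed
  have "(\<lambda>p. {fst p, snd p}) ` parcs G \<subseteq> edges G" unfolding edges_def by force
  then have "(\<Sum>e\<in>edges G. \<Sum>p\<in>{p \<in> parcs G. {fst p, snd p} = e}. 1 :: nat) = (\<Sum>p\<in>parcs G. 1)"
    by (rule sum.group[OF pair_finite_arcs finite_edges])
  then have "card (parcs G) = (\<Sum>e\<in>edges G. card {p \<in> parcs G. {fst p, snd p} = e})" by simp
  also have "\<dots> = (\<Sum>e\<in>edges G. 2)" by (rule sum.cong) (simp_all add: two)
  finally show ?thesis by simp
qed

lemma bipartite_no_odd_closed_walk: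
  assumes "bipartite G" "odd k"
  shows "(v, v) \<notin> parcs G ^^ k"
proof
  assume walk: "(v, v) \<in> parcs G ^^ k"
  obtain X Y where disj: "X \<inter> Y = {}"
      and "\<forall>(u, v)\<in>parcs G. (u \<in> X \<and> v \<in> Y) \<or> (u \<in> Y \<and> v \<in> X)"
    using assms(1) unfolding bipartite_def by blast
  then have XY: "z \<in> X \<longleftrightarrow> w \<notin> X" if "(z, w) \<in> parcs G" for z w using that by fastforce
  have "(u, w) \<in> parcs G ^^ m \<Longrightarrow> (u \<in> X \<longleftrightarrow> w \<in> X) \<longleftrightarrow> even m" for u w m
  proof (induction m arbitrary: w)
    case (Suc m)
    then obtain z where "(u, z) \<in> parcs G ^^ m" "(z, w) \<in> parcs G" by auto
    with Suc.IH[of z] XY[of z w] show ?case by simp blast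
  qed simp
  from this[OF walk] assms(2) show False by simp
qed

text \<open>One side consists of the vertices with a walk of even length from a representative of
  their component.\<close>

lemma bipartite_if_no_odd_closed_walk:
  assumes odd: "\<And>k v. odd k \<Longrightarrow> v \<in> pverts G \<Longrightarrow> (v, v) \<notin> parcs G ^^ k"
  shows "bipartite G"
proof -
  \<comment> \<open>Adjacent vertices reach the same vertices, so the choice operator picks the same
    representative for them.\<close>
  define root where "root v = (SOME r. r \<in> (parcs G)\<^sup>* `` {v})" for v
  have symR: "sym (parcs G)" using arcs_symmetric by (rule symI)
  have sympow: "(u, w) \<in> parcs G ^^ k \<Longrightarrow> (w, u) \<in> parcs G ^^ k" for u w k
  proof (induction k arbitrary: w)
    case (Suc k)
    then obtain z where "(u, z) \<in> parcs G ^^ k" "(z, w) \<in> parcs G" by auto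
    then show ?case using Suc.IH arcs_symmetric relpow_Suc_I2 by metis
  qed simp
  have root_eq: "root u = root v" if uv: "(u, v) \<in> parcs G" for u v
  proof -
    have "(parcs G)\<^sup>* `` {u} = (parcs G)\<^sup>* `` {v}"
      using uv arcs_symmetric[OF uv] by (auto intro: converse_rtrancl_into_rtrancl)
    then show ?thesis by (simp add: root_def)
  qed
  have root_reach: "(root v, v) \<in> (parcs G)\<^sup>*" for v
  proof -
    have "root v \<in> (parcs G)\<^sup>* `` {v}" unfolding root_def by (rule someI[of _ v]) simp
    then show ?thesis using sym_rtrancl[OF symR] by (auto dest: symD)
  qed
  define X where "X = {v \<in> pverts G. \<exists>k. even k \<and> (root v, v) \<in> parcs G ^^ k}"
  have X1: "\<not> (u \<in> X \<and> v \<in> X)" if uv: "(u, v) \<in> parcs G" for u v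
  proof
    assume "u \<in> X \<and> v \<in> X"
    then obtain k l where kl: "even k" "even l" "(root u, u) \<in> parcs G ^^ k" "(root u, v) \<in> parcs G ^^ l"
      using root_eq[OF uv] by (auto simp: X_def)
    \<comment> \<open>From \<open>u\<close> step to \<open>v\<close>, go back to the root along the
      walk of length \<open>l\<close>, and return to \<open>u\<close> along the walk of length
      \<open>k\<close>. With \<open>k\<close> and \<open>l\<close> even the total is odd.\<close>
    have "(u, u) \<in> parcs G ^^ (l + 1 + k)"
    proof -
      have "(root u, u) \<in> parcs G ^^ (l + 1)" using kl(4) arcs_symmetric[OF uv] by auto
      then have "(u, root u) \<in> parcs G ^^ (l + 1)" by (rule sympow)
      then show ?thesis using kl(3) by (subst relpow_add) auto
    qed
    moreover have "odd (l + 1 + k)" using kl by simp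
    ultimately show False using odd in_arcsD1[OF uv] by blast
  qed
  have X2: "u \<in> X \<or> v \<in> X" if uv: "(u, v) \<in> parcs G" for u v
  proof (rule ccontr)
    assume neg: "\<not> (u \<in> X \<or> v \<in> X)"
    obtain k where k: "(root u, u) \<in> parcs G ^^ k" using root_reach rtrancl_imp_relpow by blast
    have k': "(root v, v) \<in> parcs G ^^ Suc k" using k uv root_eq[OF uv] by auto
    show False
    proof (cases "even k")
      case True
      then have "u \<in> X" unfolding X_def using k in_arcsD1[OF uv] by blast
      with neg show False by blast
    next
      case False
      then have "even (Suc k)" by simp
      then have "v \<in> X" unfolding X_def using k' in_arcsD2[OF uv] by blast
      with neg show False by blast
    qed
  qed
  have "X \<subseteq> pverts G" by (auto simp: X_def)
  then show ?thesis unfolding bipartite_def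
    by (intro exI[of _ X] exI[of _ "pverts G - X"]) (use X1 X2 in_arcsD1 in_arcsD2 in blast)
qed

end

section \<open>Connected components\<close>

text \<open>Kept as a \<open>pair_pre_digraph\<close>, so that \<open>adjacency_mat\<close> and the
  lemmas of \<open>pair_graph\<close> apply to components.\<close>

definition induced_on :: "'a pair_pre_digraph \<Rightarrow> 'a set \<Rightarrow> 'a pair_pre_digraph" where
  "induced_on G S = \<lparr> pverts = S, parcs = {(u, v) \<in> parcs G. u \<in> S \<and> v \<in> S} \<rparr>"

lemma induced_on_simps [simp]:
  "pverts (induced_on G S) = S"
  "(u, v) \<in> parcs (induced_on G S) \<longleftrightarrow> (u, v) \<in> parcs G \<and> u \<in> S \<and> v \<in> S"
  by (auto simp: induced_on_def)

lemma with_proj_induced_on: "with_proj (induced_on G S) = with_proj G \<restriction> S"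
  by (auto simp: with_proj_def induced_on_def induce_subgraph_def)

context pair_graph
begin

lemma pair_graph_induced_on:
  assumes "S \<subseteq> pverts G"
  shows "pair_graph (induced_on G S)"
proof unfold_locales
  let ?D = "induced_on G S"
  show "fst e \<in> pverts ?D" "snd e \<in> pverts ?D" if "e \<in> parcs ?D" for e
    using that by (auto simp: induced_on_def)
  show "finite (pverts ?D)" using assms pair_finite_verts by (simp add: finite_subset)
  have "parcs ?D \<subseteq> parcs G" by (auto simp: induced_on_def)
  then show "finite (parcs ?D)" using pair_finite_arcs by (rule finite_subset)
  show "fst e \<noteq> snd e" if "e \<in> parcs ?D" for e
    using that pair_no_loops by (auto simp: induced_on_def)
  have "sym (parcs ?D)" by (rule symI) (use arcs_symmetric in simp)
  then show "symmetric (with_proj ?D)" by (simp add: symmetric_def)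
qed

lemma components_conv: "components G = (\<lambda>S. with_proj (induced_on G S)) ` sccs_verts"
  unfolding components_def sccs_conv_sccs_verts with_proj_induced_on ..

lemma num_components_conv: "num_components G = card sccs_verts"
  unfolding num_components_def components_def card_sccs_verts ..

lemma scc_subset: "S \<in> sccs_verts \<Longrightarrow> S \<subseteq> pverts G"
  using sccs_verts_subsets .

lemma scc_nonempty: "S \<in> sccs_verts \<Longrightarrow> S \<noteq> {}"
  by (simp add: in_sccs_verts_conv_reachable)

text \<open>Arcs can be reversed, so the two ends of an arc are mutually reachable.\<close>

lemma scc_closed:
  assumes S: "S \<in> sccs_verts" and u: "u \<in> S" and uv: "(u, v) \<in> parcs G"
  shows "v \<in> S"
proof (rule ccontr)
  assume "v \<notin> S"
  then have "\<not> u \<rightarrow>\<^sup>*\<^bsub>with_proj G\<^esub> v \<or> \<not> v \<rightarrow>\<^sup>*\<^bsub>with_proj G\<^esub> u"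
    using S u unfolding in_sccs_verts_conv_reachable by blast
  then show False using uv arcs_symmetric[OF uv] in_arcsD1[OF uv] in_arcsD2[OF uv]
    by (auto simp: reachable_conv)
qed

lemma Union_sccs_verts: "\<Union> sccs_verts = pverts G"
proof
  show "\<Union> sccs_verts \<subseteq> pverts G" using scc_subset by blast
  show "pverts G \<subseteq> \<Union> sccs_verts"
    using scc_of_in_sccs_verts in_scc_of_self by blast
qed

lemma connected_induced_on_scc:
  assumes S: "S \<in> sccs_verts"
  shows "Digraph_Component.connected (with_proj (induced_on G S))"
proof -
  interpret D: pair_graph "induced_on G S" by (rule pair_graph_induced_on[OF scc_subset[OF S]])
  have "with_proj (induced_on G S) \<in> sccs"
    using S unfolding sccs_conv_sccs_verts with_proj_induced_on by blast
  then have "strongly_connected (with_proj (induced_on G S))" by (rule in_sccsE)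
  then show ?thesis unfolding D.connected_iff_rtrancl strongly_connected_def
    by (auto simp: D.reachable_conv)
qed

lemma sum_card_scc: "(\<Sum>S\<in>sccs_verts. card S) = card (pverts G)"
proof -
  have "card (\<Union>S\<in>sccs_verts. S) = (\<Sum>S\<in>sccs_verts. card S)"
  proof (rule card_UN_disjoint)
    show "\<forall>S\<in>sccs_verts. finite S" using scc_subset pair_finite_verts finite_subset by blast
    show "\<forall>S\<in>sccs_verts. \<forall>T\<in>sccs_verts. S \<noteq> T \<longrightarrow> S \<inter> T = {}" using sccs_verts_disjoint by blast
  qed (rule finite_sccs_verts)
  then show ?thesis using Union_sccs_verts by simp
qed

text \<open>Edges of different components are nonempty subsets of disjoint vertex sets, hence
  different.\<close>

lemma sum_card_edges_scc_le: "(\<Sum>S\<in>sccs_verts. card (edges (induced_on G S))) \<le> card (edges G)"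
proof -
  have sub: "edges (induced_on G S) \<subseteq> edges G" for S by (auto simp: edges_def)
  have ne: "e \<noteq> {} \<and> e \<subseteq> S" if "e \<in> edges (induced_on G S)" for e S
    using that by (auto simp: edges_def)
  have "card (\<Union>S\<in>sccs_verts. edges (induced_on G S)) = (\<Sum>S\<in>sccs_verts. card (edges (induced_on G S)))"
  proof (rule card_UN_disjoint)
    show "\<forall>S\<in>sccs_verts. finite (edges (induced_on G S))" using sub finite_edges finite_subset by blast
    show "\<forall>S\<in>sccs_verts. \<forall>T\<in>sccs_verts. S \<noteq> T \<longrightarrow> edges (induced_on G S) \<inter> edges (induced_on G T) = {}"
    proof (intro ballI impI)
      fix S T assume "S \<in> sccs_verts" "T \<in> sccs_verts" "S \<noteq> T"
      then have "S \<inter> T = {}" by (rule sccs_verts_disjoint)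
      then show "edges (induced_on G S) \<inter> edges (induced_on G T) = {}" using ne by blast
    qed
  qed (rule finite_sccs_verts)
  moreover have "card (\<Union>S\<in>sccs_verts. edges (induced_on G S)) \<le> card (edges G)"
    using sub by (intro card_mono finite_edges) blast
  ultimately show ?thesis by simp
qed

text \<open>If every component had a cycle, each would have at least as many edges as vertices.
  Summing over the components contradicts the assumption.\<close>

lemma exists_tree_component:
  assumes "card (edges G) < card (pverts G)"
  shows "\<exists>C\<in>components G. tree_graph C"
proof (rule ccontr)
  assume none: "\<not> ?thesis"
  have "card S \<le> card (edges (induced_on G S))" if S: "S \<in> sccs_verts" for S
  proof -
    interpret D: pair_graph "induced_on G S" by (rule pair_graph_induced_on[OF scc_subset[OF S]])
    have "contains_cycle (with_proj (induced_on G S))"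
      using none S connected_induced_on_scc[OF S] unfolding components_conv tree_graph_def by blast
    from D.connected_cyclic_card_verts_le[OF connected_induced_on_scc[OF S] this]
    show ?thesis by simp
  qed
  then have "(\<Sum>S\<in>sccs_verts. card S) \<le> (\<Sum>S\<in>sccs_verts. card (edges (induced_on G S)))"
    by (rule sum_mono)
  then show False using assms sum_card_scc sum_card_edges_scc_le by simp
qed

section \<open>Eigenfunctions supported on components\<close>

text \<open>No arc joins a component to its outside. The eigenvalue equation is unchanged on
  \<open>S\<close> and reads \<open>0 = 0\<close> elsewhere.\<close>

lemma eigenfunction_extend:
  assumes S: "S \<in> sccs_verts" and g: "eigenfunction (induced_on G S) x g"
  shows "eigenfunction G x (\<lambda>v. if v \<in> S then g v else 0)"
    and "(\<Sum>v\<in>pverts G. if v \<in> S then g v else 0) = (\<Sum>v\<in>S. g v)"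
proof -
  have SV: "S \<subseteq> pverts G" by (rule scc_subset[OF S])
  have restrict: "(\<Sum>v\<in>pverts G. if v \<in> S then h v else 0) = (\<Sum>v\<in>S. h v)" for h :: "'a \<Rightarrow> real"
    using SV pair_finite_verts by (simp add: sum.If_cases Int_absorb1)
  then show "(\<Sum>v\<in>pverts G. if v \<in> S then g v else 0) = (\<Sum>v\<in>S. g v)" .
  have out: "(u, w) \<in> parcs G \<Longrightarrow> w \<in> S \<Longrightarrow> u \<in> S" for u w
    using scc_closed[OF S] arcs_symmetric by blast
  have "(\<Sum>w\<in>pverts G. if (u, w) \<in> parcs G then if w \<in> S then g w else 0 else 0) =
      x * (if u \<in> S then g u else 0)" for u
  proof (cases "u \<in> S")
    case True
    have "(\<Sum>w\<in>pverts G. if (u, w) \<in> parcs G then if w \<in> S then g w else 0 else 0) =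
        (\<Sum>w\<in>pverts G. if w \<in> S then if (u, w) \<in> parcs (induced_on G S) then g w else 0 else 0)"
      using True by (intro sum.cong) auto
    also have "\<dots> = x * g u" unfolding restrict using g True by (simp add: eigenfunction_def)
    finally show ?thesis using True by simp
  next
    case False
    then show ?thesis using out by (auto intro!: sum.neutral)
  qed
  moreover have "\<exists>u\<in>pverts G. (if u \<in> S then g u else 0) \<noteq> 0"
    using g SV by (auto simp: eigenfunction_def)
  ultimately show "eigenfunction G x (\<lambda>v. if v \<in> S then g v else 0)"
    unfolding eigenfunction_def by blast
qed

text \<open>Each function is nonzero at some vertex where all the others vanish. The corresponding
  vectors are therefore distinct and independent, and they lie in the eigenspace of
  \<open>x\<close>.\<close>

lemma card_disjoint_eigenfunctions_le:
  assumes fin: "finite I" and g: "\<And>S. S \<in> I \<Longrightarrow> eigenfunction G x (g S)"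
    and supp: "\<And>S v. S \<in> I \<Longrightarrow> v \<notin> S \<Longrightarrow> g S v = 0"
    and disj: "\<And>S T. S \<in> I \<Longrightarrow> T \<in> I \<Longrightarrow> S \<noteq> T \<Longrightarrow> S \<inter> T = {}"
  shows "card I \<le> Polynomial.order x (char_poly (adjacency_mat G))"
proof -
  let ?n = "card (pverts G)" and ?v = "\<lambda>S. vertex_vec G (g S)"
  let ?B = "char_matrix (adjacency_mat G) x"
  have witness: "\<exists>i<?n. ?v S $ i \<noteq> 0 \<and> (\<forall>T\<in>I. T \<noteq> S \<longrightarrow> ?v T $ i = 0)" if S: "S \<in> I" for S
  proof -
    obtain u where u: "u \<in> pverts G" "g S u \<noteq> 0" using g[OF S] by (auto simp: eigenfunction_def)
    obtain i where i: "i < ?n" "u = vertex_list G ! i" using vertex_list_obtain[OF u(1)] .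
    have "u \<in> S" using supp[OF S] u(2) by blast
    then have "g T u = 0" if "T \<in> I" "T \<noteq> S" for T using disj[OF S that(1)] supp[OF that(1)] that(2) by blast
    moreover have "?v T $ i = g T u" for T using i by (simp add: vertex_vec_def)
    ultimately show ?thesis using i(1) u(2) by (intro exI[of _ i]) simp
  qed
  have inj: "inj_on ?v I"
  proof (rule inj_onI, rule ccontr)
    fix S T assume "S \<in> I" "T \<in> I" and eq: "?v S = ?v T" and "S \<noteq> T"
    then show False using witness[of S] by (metis (no_types))
  qed
  have "indep ?n (?v ` I)"
    unfolding indep_def
  proof (intro conjI allI impI)
    fix a assume lin: "\<forall>i<?n. (\<Sum>y\<in>?v ` I. a y * y $ i) = 0"
    show "\<forall>y\<in>?v ` I. a y = 0"
    proof (rule ballI, elim imageE)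
      fix y S assume y: "y = ?v S" and S: "S \<in> I"
      obtain i where i: "i < ?n" "?v S $ i \<noteq> 0" "\<And>T. T \<in> I \<Longrightarrow> T \<noteq> S \<Longrightarrow> ?v T $ i = 0"
        using witness[OF S] by blast
      have "0 = (\<Sum>T\<in>I. a (?v T) * ?v T $ i)" using lin i(1) by (simp add: sum.reindex[OF inj])
      also have "\<dots> = (\<Sum>T\<in>{S}. a (?v T) * ?v T $ i)"
        by (rule sum.mono_neutral_right) (use fin S i(3) in auto)
      finally show "a y = 0" using i(2) y by simp
    qed
  qed (use fin in auto)
  moreover have "?v ` I \<subseteq> mat_kernel ?B"
  proof (rule image_subsetI)
    fix S assume "S \<in> I"
    then have "eigenvector (adjacency_mat G) (?v S) x" using g eigenvector_vertex_vec by blast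
    then show "?v S \<in> mat_kernel ?B"
      unfolding eigenvector_char_matrix[OF adjacency_mat_carrier]
      by (intro mat_kernelI[OF char_matrix_closed[OF adjacency_mat_carrier]]) auto
  qed
  ultimately have "card (?v ` I) \<le> kernel_dim ?B"
    using indep_card_le_kernel_dim[of ?B ?n ?n] by simp
  then show ?thesis unfolding order_char_poly_adjacency card_image[OF inj] .
qed

text \<open>The component has a main eigenvalue of its own. Extension by zero preserves the
  coordinate sum, so it is main for the whole graph.\<close>

lemma main_eigenvalue_of_component:
  assumes S: "S \<in> sccs_verts"
  obtains x where "main_eigenvalue G x" "poly (char_poly (adjacency_mat (induced_on G S))) x = 0"
proof -
  interpret D: pair_graph "induced_on G S" by (rule pair_graph_induced_on[OF scc_subset[OF S]])
  obtain x where x: "main_eigenvalue (induced_on G S) x"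
    using D.exists_main_eigenvalue scc_nonempty[OF S] by auto
  then obtain g where g: "eigenfunction (induced_on G S) x g" "(\<Sum>v\<in>S. g v) \<noteq> 0"
    unfolding D.main_eigenvalue_iff_eigenfunction by auto
  have "main_eigenvalue G x"
    unfolding main_eigenvalue_iff_eigenfunction
    using eigenfunction_extend[OF S g(1)] g(2) by metis
  then show thesis using D.main_eigenvalue_root[OF x] that by blast
qed

text \<open>Each component \<open>S\<close> is assigned a main eigenvalue \<open>x S\<close> of
  \<open>G\<close> in its own spectrum, and the minimal polynomial \<open>f S\<close> of that
  number. Components are grouped by this polynomial, and \<open>F\<close> is the set of polynomials
  that occur.\<close>

lemma num_components_le_sum_multiplicity:
  "\<exists>F :: rat poly set. finite F \<and>
    (\<forall>f\<in>F. lead_coeff f = 1 \<and> irreducible f \<and>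
      (\<exists>x. poly (map_poly of_rat f) x = 0 \<and> main_eigenvalue G x)) \<and>
    num_components G \<le> (\<Sum>f\<in>F. multiplicity f (char_poly (adjacency_mat G)))"
proof -
  let ?P = "\<lambda>S x f. main_eigenvalue G x \<and> lead_coeff f = 1 \<and> irreducible f \<and>
      poly (map_poly of_rat f) x = 0 \<and> f dvd char_poly (adjacency_mat (induced_on G S))"
  have "\<exists>x f. ?P S x f" if S: "S \<in> sccs_verts" for S
  proof -
    interpret D: pair_graph "induced_on G S" by (rule pair_graph_induced_on[OF scc_subset[OF S]])
    obtain x where x: "main_eigenvalue G x" "poly (char_poly (adjacency_mat (induced_on G S))) x = 0"
      using main_eigenvalue_of_component[OF S] .
    let ?p = "char_poly (adjacency_mat (induced_on G S)) :: rat poly"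
    have "?p \<noteq> 0" using D.char_poly_adjacency_nonzero unfolding D.char_poly_adjacency_of_rat by auto
    moreover have px: "poly (map_poly of_rat ?p) x = 0" using x(2) unfolding D.char_poly_adjacency_of_rat .
    ultimately obtain f where f: "lead_coeff f = 1" "irreducible f" "poly (map_poly of_rat f) x = 0"
      by (rule exists_minimal_polynomial)
    moreover have "f dvd ?p" using irreducible_not_dvd_no_common_root[OF f(2,3)] px by blast
    ultimately show ?thesis using x(1) by blast
  qed
  then obtain x f where xf: "\<And>S. S \<in> sccs_verts \<Longrightarrow> ?P S (x S) (f S)" by metis
  have mult: "card {S \<in> sccs_verts. f S = h} \<le> multiplicity h (char_poly (adjacency_mat G))"
    if h: "h \<in> f ` sccs_verts" for h
  proof -
    obtain R where R: "R \<in> sccs_verts" "h = f R" using h by blast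
    \<comment> \<open>One root of \<open>h\<close> serves the whole group: \<open>h\<close> divides
      the characteristic polynomial of every component in it, so \<open>y\<close> is an eigenvalue
      of each, whatever number was first assigned.\<close>
    define y where "y = x R"
    have hy: "irreducible h" "poly (map_poly of_rat h) y = 0" using xf[OF R(1)] R(2) y_def by auto
    have "\<exists>g. eigenfunction G y g \<and> (\<forall>v. v \<notin> S \<longrightarrow> g v = 0)" if S: "S \<in> {S \<in> sccs_verts. f S = h}" for S
    proof -
      have S': "S \<in> sccs_verts" "f S = h" using S by auto
      interpret D: pair_graph "induced_on G S" by (rule pair_graph_induced_on[OF scc_subset[OF S'(1)]])
      have "h dvd char_poly (adjacency_mat (induced_on G S))" using xf[OF S'(1)] S'(2) by blast
      then obtain q where "char_poly (adjacency_mat (induced_on G S)) = h * q" by (rule dvdE)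
      then have "poly (char_poly (adjacency_mat (induced_on G S))) y = 0"
        unfolding D.char_poly_adjacency_of_rat using hy(2) by (simp add: map_poly_of_rat_mult)
      then obtain v where v: "eigenvector (adjacency_mat (induced_on G S)) v y"
        unfolding eigenvalue_root_char_poly[OF adjacency_mat_carrier, symmetric] eigenvalue_def by blast
      then have "v \<in> carrier_vec (card (pverts (induced_on G S)))" by (simp add: eigenvector_def)
      then obtain g where "v = vertex_vec (induced_on G S) g" by (rule D.vertex_vec_surj)
      then have "eigenfunction (induced_on G S) y g" using v D.eigenvector_vertex_vec by blast
      from eigenfunction_extend(1)[OF S'(1) this] show ?thesis
        by (intro exI[of _ "\<lambda>v. if v \<in> S then g v else 0"]) simp
    qed
    then obtain g where g: "\<And>S. S \<in> {S \<in> sccs_verts. f S = h} \<Longrightarrow>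
        eigenfunction G y (g S) \<and> (\<forall>v. v \<notin> S \<longrightarrow> g S v = 0)" by metis
    have "card {S \<in> sccs_verts. f S = h} \<le> Polynomial.order y (char_poly (adjacency_mat G))"
    proof (rule card_disjoint_eigenfunctions_le)
      show "finite {S \<in> sccs_verts. f S = h}" using finite_sccs_verts by simp
      show "eigenfunction G y (g S)" if "S \<in> {S \<in> sccs_verts. f S = h}" for S using g[OF that] by blast
      show "g S v = 0" if "S \<in> {S \<in> sccs_verts. f S = h}" "v \<notin> S" for S v using g[OF that(1)] that(2) by blast
      show "S \<inter> T = {}" if "S \<in> {S \<in> sccs_verts. f S = h}" "T \<in> {S \<in> sccs_verts. f S = h}" "S \<noteq> T" for S T
        using sccs_verts_disjoint that by blast
    qed
    moreover have "char_poly (adjacency_mat G :: rat mat) \<noteq> 0"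
      using char_poly_adjacency_nonzero unfolding char_poly_adjacency_of_rat by auto
    ultimately show ?thesis
      unfolding char_poly_adjacency_of_rat using order_eq_multiplicity[OF hy] by simp
  qed
  have "(\<Sum>h\<in>f ` sccs_verts. \<Sum>S\<in>{S \<in> sccs_verts. f S = h}. 1 :: nat) = (\<Sum>S\<in>sccs_verts. 1)"
    by (rule sum.group) (use finite_sccs_verts in auto)
  then have "num_components G = (\<Sum>h\<in>f ` sccs_verts. card {S \<in> sccs_verts. f S = h})"
    unfolding num_components_conv by simp
  also have "\<dots> \<le> (\<Sum>h\<in>f ` sccs_verts. multiplicity h (char_poly (adjacency_mat G)))"
    by (rule sum_mono) (rule mult)
  finally have "num_components G \<le> (\<Sum>h\<in>f ` sccs_verts. multiplicity h (char_poly (adjacency_mat G)))" .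
  moreover have "finite (f ` sccs_verts)" using finite_sccs_verts by simp
  moreover have "\<forall>h\<in>f ` sccs_verts. lead_coeff h = 1 \<and> irreducible h \<and>
      (\<exists>x. poly (map_poly of_rat h) x = 0 \<and> main_eigenvalue G x)"
    using xf by blast
  ultimately show ?thesis by (intro exI[of _ "f ` sccs_verts"] conjI)
qed

end

section \<open>The bound by the main-factor multiplicity, and the conclusion for trees\<close>

text \<open>Monic irreducible polynomials are normalized primes, so these are among the prime
  factors of a nonzero polynomial. Finiteness lets the sum in
  \<open>main_factor_multiplicity\<close> bound its partial sums.\<close>

lemma (in pair_graph) finite_main_factors:
  "finite {f. lead_coeff f = 1 \<and> irreducible f \<and> f dvd char_poly (adjacency_mat G :: rat mat) \<and>
    map_poly of_rat f dvd main_poly G}"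
proof (rule finite_subset)
  let ?p = "char_poly (adjacency_mat G) :: rat poly"
  show "finite (prime_factors ?p)" by simp
  have "?p \<noteq> 0" using char_poly_adjacency_nonzero unfolding char_poly_adjacency_of_rat by auto
  moreover have "prime f" if "lead_coeff f = 1" "irreducible f" for f :: "rat poly"
  proof -
    have "normalize f = f" unfolding normalize_poly_def using that(1) by (simp flip: one_pCons)
    then show ?thesis using irreducible_imp_prime_elem[OF that(2)] by (simp add: prime_def)
  qed
  ultimately show "{f. lead_coeff f = 1 \<and> irreducible f \<and> f dvd ?p \<and>
      map_poly of_rat f dvd main_poly G} \<subseteq> prime_factors ?p"
    by (auto simp: in_prime_factors_iff)
qed

text \<open>The multiplicity criterion for main eigenvalues involves only the characteristic
  polynomials of the graph and its complement, which \<open>G\<close> and \<open>H\<close> share. So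
  the factors found for \<open>H\<close> are among the main factors of \<open>G\<close>.\<close>

lemma num_components_le_main_factor_multiplicity:
  assumes "pair_graph G" "pair_graph H" and cosp: "generalized_cospectral G H"
  shows "num_components H \<le> main_factor_multiplicity G"
proof -
  interpret G: pair_graph G by fact
  interpret H: pair_graph H by fact
  let ?p = "char_poly (adjacency_mat G) :: rat poly"
  have p: "char_poly (adjacency_mat H) = ?p"
    and q: "char_poly (adjacency_mat (complement_graph H) :: rat mat) = char_poly (adjacency_mat (complement_graph G))"
    using cospectral_char_poly_eq[OF assms(1,2)]
      cospectral_char_poly_eq[OF G.pair_graph_complement H.pair_graph_complement] cosp
    by (auto simp: generalized_cospectral_def)
  let ?K = "{f. lead_coeff f = 1 \<and> irreducible f \<and> f dvd ?p \<and> map_poly of_rat f dvd main_poly G}"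
  obtain F :: "rat poly set" where F: "finite F"
    "\<forall>f\<in>F. lead_coeff f = 1 \<and> irreducible f \<and>
      (\<exists>x. poly (map_poly of_rat f) x = 0 \<and> main_eigenvalue H x)"
    "num_components H \<le> (\<Sum>f\<in>F. multiplicity f (char_poly (adjacency_mat H)))"
    using H.num_components_le_sum_multiplicity by blast
  have "F \<subseteq> ?K"
  proof
    fix f assume "f \<in> F"
    then obtain x where f: "lead_coeff f = 1" "irreducible f" "poly (map_poly of_rat f) x = 0"
      and x: "main_eigenvalue H x" using F(2) by blast
    have "main_eigenvalue G x"
      using x unfolding H.main_eigenvalue_iff_multiplicity[OF f(2,3)]
        G.main_eigenvalue_iff_multiplicity[OF f(2,3)] p q .
    then show "f \<in> ?K" using f(1,2) G.main_eigenvalue_factor_dvd_main_poly[OF f(2,3)] by blast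
  qed
  then have "(\<Sum>f\<in>F. multiplicity f ?p) \<le> (\<Sum>f\<in>?K. multiplicity f ?p)"
    by (intro sum_mono2 G.finite_main_factors) simp_all
  then show ?thesis using F(3) unfolding p main_factor_multiplicity_def Let_def by linarith
qed

theorem proposition3p3:
  fixes T :: "'a pair_pre_digraph" and H :: "'b pair_pre_digraph" and n :: nat
  assumes "pair_graph T" and "tree_graph (with_proj T)" and "card (pverts T) = n"
    and "pair_graph H"
    and "generalized_cospectral T H"
  shows "card (pverts H) = n
    \<and> int (card (edges H)) = int n - 1
    \<and> bipartite H
    \<and> cycle_rank H = int (num_components H) - 1
    \<and> int (num_components H) - 1 \<le> int (main_factor_multiplicity T) - 1
    \<and> int (num_cyclic_components H) \<le> int (num_components H) - 1
    \<and> (\<exists>C \<in> components H. tree_graph C)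
    \<and> (main_factor_multiplicity T = 1 \<longrightarrow>
         Digraph_Component.connected (with_proj H) \<and> tree_graph (with_proj H))"
proof -
  interpret T: pair_graph T by fact
  interpret H: pair_graph H by fact
  have spec: "adjacency_spectrum T = adjacency_spectrum H"
    using assms(5) by (simp add: generalized_cospectral_def)
  have T_tree: "Digraph_Component.connected (with_proj T)" "\<not> contains_cycle (with_proj T)"
    using assms(2) by (auto simp: tree_graph_def)
  have verts: "card (pverts H) = n"
    using cospectral_char_poly_eq(1)[OF assms(1,4) spec] assms(3) by simp
  \<comment> \<open>The sum of the squared eigenvalues counts the arcs.\<close>
  have "real (card (parcs H)) = real (card (parcs T))"
    unfolding H.sum_spectrum_square[symmetric] T.sum_spectrum_square[symmetric] spec ..
  then have "card (edges H) = card (edges T)" unfolding H.card_parcs T.card_parcs by simp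
  then have edges: "Suc (card (edges H)) = n"
    using T.tree_card_edges_bipartite(1)[OF T_tree] assms(3) by simp
  have bip: "bipartite H"
  proof (rule H.bipartite_if_no_odd_closed_walk)
    fix k :: nat and v assume "odd k" "v \<in> pverts H"
    moreover have "(\<Sum>a\<in>#adjacency_spectrum T. a ^ k) = 0"
      unfolding T.sum_spectrum_power_eq_0_iff
      using T.bipartite_no_odd_closed_walk[OF T.tree_card_edges_bipartite(2)[OF T_tree] \<open>odd k\<close>] by blast
    ultimately show "(v, v) \<notin> parcs H ^^ k"
      unfolding spec H.sum_spectrum_power_eq_0_iff by blast
  qed
  have le: "num_components H \<le> main_factor_multiplicity T"
    by (rule num_components_le_main_factor_multiplicity[OF assms(1,4,5)])
  obtain C where C: "C \<in> components H" "tree_graph C"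
    using H.exists_tree_component edges verts by auto
  have fin: "finite (components H)" unfolding H.components_conv using H.finite_sccs_verts by simp
  \<comment> \<open>The inequality is strict because the tree component \<open>C\<close> is not
    counted on the left.\<close>
  have "num_cyclic_components H < num_components H"
    unfolding num_cyclic_components_def num_components_def
    using C by (intro psubset_card_mono[OF fin]) (auto simp: tree_graph_def)
  moreover have "Digraph_Component.connected (with_proj H) \<and> tree_graph (with_proj H)"
    if "main_factor_multiplicity T = 1"
  proof -
    \<comment> \<open>The strict inequality just shown makes the number of components
      positive.\<close>
    have "num_components H = 1" using le that calculation by simp
    then have "card H.sccs_verts = 1" unfolding H.num_components_conv .
    then obtain S where S: "H.sccs_verts = {S}" by (rule card_1_singletonE)
    then have "S = pverts H" using H.Union_sccs_verts by simp
    then have "induced_on H S = H"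
      using H.in_arcsD1 H.in_arcsD2 by (auto simp: induced_on_def intro!: pair_pre_digraph.equality)
    moreover have "Digraph_Component.connected (with_proj (induced_on H S))"
      by (rule H.connected_induced_on_scc) (simp add: S)
    ultimately have conn: "Digraph_Component.connected (with_proj H)" by simp
    \<comment> \<open>A connected graph with a cycle has at least as many edges as vertices, but
      \<open>H\<close> has one edge fewer.\<close>
    then show ?thesis
      using H.connected_cyclic_card_verts_le[OF conn] edges verts by (auto simp: tree_graph_def)
  qed
  ultimately show ?thesis
    using verts edges bip le C by (auto simp: cycle_rank_def)
qed

end
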